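(* Let $\alpha>-1$ and let $n\in\mathbb N$ be fixed. As $t\to+\infty$, the sub-leading coefficient $\mathrm p(n,t)$ and the quantity $H_n(t)=t\frac{d}{dt}\ln D_n(t)$ have the asymptotic expansions $$\mathrm p(n,t)=-n\sqrt t-\frac{n(2\alpha+3n)}{4}-\frac{n\left[4(\alpha+n)^2-1\right]}{32\sqrt t}+O(t^{-1}),$$ $$H_n(t)=-n\sqrt t+\frac{n(2\alpha+n)}{4}-\frac{n\left[4(\alpha+n)^2-1\right]}{32\sqrt t}+O(t^{-1}).$$
   Context: For $\alpha>-1$, $t\ge0$, let $w(x;t,\alpha)=x^\alpha e^{-x-t/x}$ on $(0,\infty)$, with moments $\mu_j(t,\alpha)=\int_0^\infty x^jw(x;t,\alpha)\,dx$ and Hankel determinant $D_n(t)=D_n(t,\alpha)=\det(\mu_{i+j}(t,\alpha))_{i,j=0}^{n-1}$. $P_n(x;t,\alpha)$ is the monic polynomial of degree $n$ orthogonal with respect to $w$ ($\int_0^\infty P_jP_kw\,dx=h_j\delta_{jk}$, $h_j>0$), and $\mathrm p(n,t)$ is the coefficient of $x^{n-1}$ in $P_n(x;t,\alpha)$. $\mathbb N$ denotes the positive integers. *)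

theory Defs
  imports "HOL-Analysis.Analysis" "HOL-Library.Landau_Symbols" "Jordan_Normal_Form.Determinant"
begin

definition weight :: "real \<Rightarrow> real \<Rightarrow> real \<Rightarrow> real" where
  "weight \<alpha> t x = x powr \<alpha> * exp (- x - t / x)"

definition moment :: "real \<Rightarrow> real \<Rightarrow> nat \<Rightarrow> real" where
  "moment \<alpha> t j = (LBINT x:{0<..}. x ^ j * weight \<alpha> t x)"

definition hankel_det :: "real \<Rightarrow> nat \<Rightarrow> real \<Rightarrow> real" where
  "hankel_det \<alpha> n t = Determinant.det (Matrix.mat n n (\<lambda>(i, j). moment \<alpha> t (i + j)))"

definition monic_orthogonal :: "real \<Rightarrow> real \<Rightarrow> (nat \<Rightarrow> real poly) \<Rightarrow> bool" where
  "monic_orthogonal \<alpha> t P \<longleftrightarrow>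
     (\<forall>n. degree (P n) = n \<and> lead_coeff (P n) = 1) \<and>
     (\<exists>h :: nat \<Rightarrow> real. (\<forall>j. h j > 0) \<and>
        (\<forall>j k. (LBINT x:{0<..}. poly (P j) x * poly (P k) x * weight \<alpha> t x)
                = (if j = k then h j else 0)))"

text \<open>The definite description is only meaningful when exactly one such sequence exists,
  which is the case for \<open>\<alpha> > -1\<close> and \<open>t \<ge> 0\<close> (Gram--Schmidt).\<close>

definition ortho_poly :: "real \<Rightarrow> real \<Rightarrow> nat \<Rightarrow> real poly" where
  "ortho_poly \<alpha> t = (THE P. monic_orthogonal \<alpha> t P)"

text \<open>The degree-\<open>n - 1\<close> coefficient; used for \<open>n \<ge> 1\<close> only.\<close>

definition subleading :: "real \<Rightarrow> nat \<Rightarrow> real \<Rightarrow> real" where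
  "subleading \<alpha> n t = coeff (ortho_poly \<alpha> t n) (n - 1)"

definition H_log :: "real \<Rightarrow> nat \<Rightarrow> real \<Rightarrow> real" where
  "H_log \<alpha> n t = t * deriv (\<lambda>s. ln (hankel_det \<alpha> n s)) t"

end

(*
  Let P_k be the monic orthogonal polynomials, h_k their squared norms, and put
    a_k = t/h_k * int P_k^2 w/x > 0,   c_k = -t/h_(k-1) * int P_k P_(k-1) w/x,   c_0 = 0.
  Integrating by parts against w'/w = alpha/x - 1 + t/x^2 shows that the diagonal recurrence
  coefficient of P_k is 2k+1+alpha+a_k, and that
    a_k^2 + (2k+1+alpha) a_k = t + c_k + c_(k+1),
    c_k (c_k + t) (a_k + a_(k-1)) = (k t + (2k+alpha) c_k) a_k a_(k-1).
  Moreover H_n = -sum_(k<n) a_k and p(n,t) = H_n - n(n+alpha).  Since c_k > 0 for k >= 1, the system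
  forces a_k/sqrt t and c_k/sqrt t to be bounded, and then it can be solved by bootstrapping: each
  passage through the two equations improves the error term by a factor 1/sqrt t, so that after
  finitely many steps
    a_k = sqrt t - (2k+1+2 alpha)/4 + (2k+1+2 alpha)(6k+3+2 alpha)/(32 sqrt t) + O(1/t).
  No asymptotics of Bessel functions or of Painleve transcendents is needed.
*)
theory Submission
  imports Defs "HOL-Real_Asymp.Real_Asymp"
begin

text \<open>The obstacle is that the system has no starting point for an induction on k: the
  equation for a_0 already contains c_1, and c_(k+1) is tied to a_(k+1). Positivity takes the place
  of induction. Since a_k a_(k-1) / (a_k + a_(k-1)) is smaller than either factor, the second
  equation bounds c_k by a constant times a_k and also by the same constant times a_(k-1). So both
  c_k and c_(k+1) are dominated by a_k, and the first equation, quadratic in a_k, bounds a_k / sqrt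
  t for each k on its own. Positivity of c_k and the second equation have a common source: c_k (c_k
  + t) and k t + (2k + \<alpha>) c_k both equal h_k / h_(k-1) times an expression in a_k and
  a_(k-1). The first is quadratic and leaves two signs open; the linear one decides between them,
  and the quotient of both removes the norms. All this algebra takes place at one fixed t, for an
  abstract positive functional obeying the Pearson identity. The base functional carries x^-2
  because the term t/x^2 of w'/w brings in that power.\<close>

hide_const (open) Module.smult

section \<open>Orthogonal polynomials of a singular Laguerre functional\<close>

lemma two_mult_poly: "2 * (q :: real poly) = smult 2 q"
  by (simp add: numeral_poly)

text \<open>\<open>N p\<close> stands for \<open>\<integral> p x\<^sup>-\<^sup>2 w\<close>: the factor \<open>x\<^sup>-\<^sup>2\<close> makes every integral that occurs below
  the value of \<open>N\<close> at a genuine polynomial.\<close>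

locale singular_laguerre_functional =
  fixes N :: "real poly \<Rightarrow> real" and \<alpha> t :: real
  assumes N_add: "N (p + q) = N p + N q"
    and N_smult: "N (smult c p) = c * N p"
    and N_pos: "p \<noteq> 0 \<Longrightarrow> (\<And>x. x > 0 \<Longrightarrow> poly p x \<ge> 0) \<Longrightarrow> N p > 0"
    and pearson: "N ([:0, 0, 1:] * pderiv p) = N ([:-t, -\<alpha>, 1:] * p)"
    and \<alpha>: "\<alpha> > -1" and t: "t > 0"
begin

text \<open>If \<open>N\<close> integrates against w/x^2, then \<open>J\<close> integrates against
  w/x and \<open>L\<close> against w itself. Orthogonality refers to \<open>L\<close>.\<close>

definition J :: "real poly \<Rightarrow> real" where "J p = N (pCons 0 p)"
definition L :: "real poly \<Rightarrow> real" where "L p = J (pCons 0 p)"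

lemma N_0 [simp]: "N 0 = 0"
  using N_smult[of 0 0] by simp

lemma N_diff: "N (p - q) = N p - N q"
  using N_add[of "p - q" q] by simp

lemma J_lin: "J 0 = 0" "J (p + q) = J p + J q" "J (p - q) = J p - J q" "J (smult c p) = c * J p"
  using N_add[of "pCons 0 p" "pCons 0 q"] N_diff[of "pCons 0 p" "pCons 0 q"] N_smult[of c "pCons 0 p"]
  by (simp_all add: J_def)

lemma L_lin: "L 0 = 0" "L (p + q) = L p + L q" "L (p - q) = L p - L q" "L (smult c p) = c * L p"
  using J_lin(2)[of "pCons 0 p" "pCons 0 q"] J_lin(3)[of "pCons 0 p" "pCons 0 q"] J_lin(4)[of c "pCons 0 p"]
  by (simp_all add: L_def J_lin)

lemma J_pos: "p \<noteq> 0 \<Longrightarrow> (\<And>x. x > 0 \<Longrightarrow> poly p x \<ge> 0) \<Longrightarrow> J p > 0"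
  unfolding J_def by (rule N_pos) auto

lemma L_pos: "p \<noteq> 0 \<Longrightarrow> (\<And>x. x > 0 \<Longrightarrow> poly p x \<ge> 0) \<Longrightarrow> L p > 0"
  unfolding L_def by (rule J_pos) auto

lemma L_square_pos: "p \<noteq> 0 \<Longrightarrow> L (p * p) > 0"
  by (rule L_pos) auto

lemma J_square_pos: "p \<noteq> 0 \<Longrightarrow> J (p * p) > 0"
  by (rule J_pos) auto

section \<open>Monic orthogonal polynomials from the three-term recurrence\<close>

fun ortho :: "nat \<Rightarrow> real poly" where
  "ortho 0 = 1"
| "ortho (Suc n) = [:- (L (pCons 0 (ortho n * ortho n)) / L (ortho n * ortho n)), 1:] * ortho n
     - (if n = 0 then 0 else smult (L (ortho n * ortho n) / L (ortho (n - 1) * ortho (n - 1))) (ortho (n - 1)))"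

declare ortho.simps(2) [simp del]

definition h :: "nat \<Rightarrow> real" where "h n = L (ortho n * ortho n)"
definition diag :: "nat \<Rightarrow> real" where "diag n = L (pCons 0 (ortho n * ortho n)) / h n"

lemma ortho_Suc_0: "ortho (Suc 0) = [:- diag 0, 1:]"
  by (simp add: ortho.simps(2) diag_def h_def)

lemma ortho_Suc_Suc: "ortho (Suc (Suc n)) =
    pCons 0 (ortho (Suc n)) - smult (diag (Suc n)) (ortho (Suc n)) - smult (h (Suc n) / h n) (ortho n)"
  by (simp add: ortho.simps(2)[of "Suc n"] diag_def h_def)

lemma ortho_degree_coeff: "degree (ortho n) = n \<and> coeff (ortho n) n = 1"
proof (induction n rule: less_induct)
  case (less n)
  consider "n = 0" | "n = Suc 0" | m where "n = Suc (Suc m)"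
    by (metis not0_implies_Suc)
  then show ?case
  proof cases
    case 3
    have IH: "degree (ortho m) = m" "degree (ortho (Suc m)) = Suc m" "coeff (ortho (Suc m)) (Suc m) = 1"
      using less.IH 3 by auto
    have "coeff (ortho n) n = 1"
      using IH by (simp add: 3 ortho_Suc_Suc coeff_eq_0)
    moreover have "degree (ortho n) \<le> n"
      unfolding 3 ortho_Suc_Suc using IH
      by (intro degree_diff_le degree_smult_le[THEN order_trans] degree_pCons_le[THEN order_trans]) auto
    ultimately show ?thesis by (metis le_degree le_antisym zero_neq_one)
  qed (simp_all add: ortho_Suc_0)
qed

lemma degree_ortho [simp]: "degree (ortho n) = n" and coeff_ortho [simp]: "coeff (ortho n) n = 1"
  using ortho_degree_coeff by auto

lemma ortho_nonzero [simp]: "ortho n \<noteq> 0"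
  using coeff_ortho[of n] by fastforce

lemma h_pos: "h n > 0"
  unfolding h_def by (rule L_square_pos) simp

lemma L_shift: "L (pCons 0 p * q) = L (p * pCons 0 q)"
  by (simp add: mult_pCons_left mult_pCons_right)

lemma degree_reduce:
  fixes q :: "real poly"
  assumes "degree q \<le> n"
  shows "q - smult (coeff q n) (ortho n) = 0 \<or> degree (q - smult (coeff q n) (ortho n)) < n"
proof -
  let ?r = "q - smult (coeff q n) (ortho n)"
  have "degree ?r \<le> n" using assms by (intro degree_diff_le degree_smult_le[THEN order_trans]) auto
  moreover have "coeff ?r n = 0" by simp
  ultimately show ?thesis by (metis eq_zero_or_degree_less)
qed

text \<open>The recurrence is the definition here, so orthogonality has to be derived from it.
  Multiplication by x is symmetric for \<open>L\<close>; hence a test polynomial of degree below m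
  meets only inductively known zeros. The two directions that remain, \<open>ortho m\<close> and
  \<open>ortho (Suc m)\<close>, are annihilated by the choice of the two recurrence
  coefficients.\<close>

lemma L_ortho_orthogonal: "degree q < n \<Longrightarrow> L (ortho n * q) = 0"
proof (induction n arbitrary: q rule: less_induct)
  case (less n)
  have top: "L (ortho m * q) = coeff q m * h m" if "m < n" "degree q \<le> m" for m q
  proof -
    let ?r = "q - smult (coeff q m) (ortho m)"
    have "L (ortho m * ?r) = 0"
      using degree_reduce[OF that(2)] less.IH[OF that(1), of ?r] by (auto simp: L_lin)
    then show ?thesis by (simp add: right_diff_distrib L_lin h_def)
  qed
  consider "n = Suc 0" | m where "n = Suc (Suc m)"
    using less.prems by (metis gr_implies_not0 not0_implies_Suc)
  then show ?case
  proof cases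
    case 1
    then obtain c where q: "q = [:c:]" using less.prems by (metis degree_eq_zeroE less_one One_nat_def)
    have "L (pCons 0 1) = diag 0 * L 1" using h_pos[of 0] by (simp add: diag_def h_def)
    moreover have "ortho n * q = smult c (pCons 0 1 - smult (diag 0) 1)"
      unfolding 1 q ortho_Suc_0 by (simp add: one_pCons)
    ultimately show ?thesis by (simp only: L_lin) simp
  next
    case 2
    have e: "L (ortho n * q) = L (ortho (Suc m) * pCons 0 q) - diag (Suc m) * L (ortho (Suc m) * q)
        - h (Suc m) / h m * L (ortho m * q)" for q
      unfolding 2 ortho_Suc_Suc L_shift[symmetric] by (simp add: left_diff_distrib L_lin)
    have low: "L (ortho n * s) = 0" if "degree s < m \<or> s = 0" for s
    proof -
      have "degree (pCons 0 s) \<le> m" "degree s < m \<or> s = 0"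
        using that by (auto intro: degree_pCons_le[THEN order_trans])
      then have "L (ortho (Suc m) * pCons 0 s) = 0" "L (ortho (Suc m) * s) = 0" "L (ortho m * s) = 0"
        using less.IH[of "Suc m" "pCons 0 s"] less.IH[of "Suc m" s] less.IH[of m s] 2 by (auto simp: L_lin)
      then show ?thesis by (simp add: e)
    qed
    have mid: "L (ortho n * ortho m) = 0"
    proof -
      have "L (ortho (Suc m) * pCons 0 (ortho m)) = h (Suc m)"
        using top[of "Suc m" "pCons 0 (ortho m)"] 2 by simp
      moreover have "L (ortho (Suc m) * ortho m) = 0" using less.IH[of "Suc m" "ortho m"] 2 by simp
      ultimately show ?thesis using h_pos[of m] by (simp add: e h_def)
    qed
    have upper: "L (ortho n * ortho (Suc m)) = 0"
    proof -
      have "L (ortho m * ortho (Suc m)) = 0" using less.IH[of "Suc m" "ortho m"] 2 by (simp add: mult.commute)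
      moreover have "L (ortho (Suc m) * pCons 0 (ortho (Suc m))) = diag (Suc m) * h (Suc m)"
        using h_pos[of "Suc m"] by (simp add: diag_def)
      ultimately show ?thesis by (simp add: e h_def)
    qed
    define r where "r = q - smult (coeff q (Suc m)) (ortho (Suc m))"
    have "degree r < Suc m \<or> r = 0"
      unfolding r_def using degree_reduce[of q "Suc m"] less.prems 2 by auto
    then have r: "degree r \<le> m" by auto
    define s where "s = r - smult (coeff r m) (ortho m)"
    have s: "degree s < m \<or> s = 0" unfolding s_def using degree_reduce[OF r] by auto
    have "q = s + smult (coeff r m) (ortho m) + smult (coeff q (Suc m)) (ortho (Suc m))"
      by (simp add: s_def r_def)
    then show ?thesis
      by (metis (no_types, lifting) L_lin(2,4) add_0 distrib_left low[OF s] mid mult_smult_right mult_zero_right upper)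
  qed
qed

lemma L_ortho_top: "degree q \<le> n \<Longrightarrow> L (ortho n * q) = coeff q n * h n"
proof -
  assume q: "degree q \<le> n"
  let ?r = "q - smult (coeff q n) (ortho n)"
  have "L (ortho n * ?r) = 0"
    using degree_reduce[OF q] L_ortho_orthogonal[of ?r n] by (auto simp: L_lin)
  then show ?thesis by (simp add: right_diff_distrib L_lin h_def)
qed

lemma L_ortho_ortho: "L (ortho j * ortho k) = (if j = k then h j else 0)"
  using L_ortho_orthogonal[of "ortho k" j] L_ortho_orthogonal[of "ortho j" k]
  by (auto simp: h_def mult.commute neq_iff)

section \<open>Products of orthogonal polynomials integrated against w/x and w/x^2\<close>

definition \<nu> :: "nat \<Rightarrow> real" where "\<nu> n = J (ortho n)"
definition \<sigma> :: "nat \<Rightarrow> real" where "\<sigma> n = N (ortho n)"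

text \<open>Write q = q(0) + x r. The factor x turns the second part into an integral against w,
  where orthogonality leaves only the top coefficient.\<close>

lemma J_ortho_mult:
  assumes "degree q \<le> Suc n"
  shows "J (ortho n * q) = coeff q 0 * \<nu> n + coeff q (Suc n) * h n"
proof (cases q)
  case (pCons b r)
  have "degree r \<le> n" using assms pCons by (cases "r = 0") auto
  then have "L (ortho n * r) = coeff r n * h n" by (rule L_ortho_top)
  then show ?thesis by (simp add: pCons J_lin \<nu>_def L_def)
qed

text \<open>The same splitting is applied twice. After one division by x the degree is at most n, so
  the norm term of \<open>J_ortho_mult\<close> drops out.\<close>

lemma N_ortho_mult:
  assumes "degree q \<le> Suc n"
  shows "N (ortho n * q) = coeff q 0 * \<sigma> n + coeff q 1 * \<nu> n"
proof (cases q)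
  case (pCons b r)
  have "degree r \<le> n" using assms pCons by (cases "r = 0") auto
  then have "J (ortho n * r) = coeff r 0 * \<nu> n" using J_ortho_mult[of r n] by (simp add: coeff_eq_0)
  then show ?thesis by (simp add: pCons N_add N_smult J_def \<sigma>_def)
qed

definition a :: "nat \<Rightarrow> real" where "a n = t * J (ortho n * ortho n) / h n"
definition c :: "nat \<Rightarrow> real" where
  "c n = (case n of 0 \<Rightarrow> 0 | Suc m \<Rightarrow> - t * J (ortho (Suc m) * ortho m) / h m)"

lemma a_pos: "a n > 0"
  unfolding a_def using J_square_pos[of "ortho n"] h_pos[of n] t by simp

lemma a_eq: "a n = t * (coeff (ortho n) 0 * \<nu> n) / h n"
  unfolding a_def by (simp add: J_ortho_mult coeff_eq_0)

lemma c_eq: "c (Suc m) = - t * (coeff (ortho m) 0 * \<nu> (Suc m)) / h m"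
  unfolding c_def by (simp add: J_ortho_mult coeff_eq_0)

text \<open>The integral behind \<open>c (Suc m)\<close> is expanded at the other factor. Its degree
  is one higher, so the norm term survives and produces the shift by t.\<close>

lemma c_eq': "c (Suc m) + t = - t * (coeff (ortho (Suc m)) 0 * \<nu> m) / h m"
proof -
  have "J (ortho (Suc m) * ortho m) = coeff (ortho (Suc m)) 0 * \<nu> m + h m"
    by (subst mult.commute) (simp add: J_ortho_mult)
  then show ?thesis using h_pos[of m] by (simp add: c_def field_simps)
qed

text \<open>In the product of the two expansions of one integral, each value at 0 can be paired with
  the \<open>\<nu>\<close> of its own index, and each such pair is an \<open>a\<close> up to
  norms.\<close>

lemma c_mult: "c (Suc m) * (c (Suc m) + t) = h (Suc m) / h m * a (Suc m) * a m"
  unfolding c_eq' unfolding c_eq a_eq using h_pos[of m] h_pos[of "Suc m"]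
  by (simp add: field_simps)

section \<open>Integration by parts and the closed system for a and c\<close>

lemma pearson_shift: "N (pCons 0 (pCons 0 (pderiv p))) = L p - \<alpha> * J p - t * N p"
proof -
  have "[:-t, -\<alpha>, 1:] * p = pCons 0 (pCons 0 p) - smult \<alpha> (pCons 0 p) - smult t p"
    by (simp add: mult_pCons_left)
  moreover have "[:0, 0, 1:] * pderiv p = pCons 0 (pCons 0 (pderiv p))"
    by (simp add: mult_pCons_left)
  ultimately show ?thesis using pearson[of p] by (simp only: N_diff N_smult L_def J_def)
qed

lemma L_pderiv: "L (pderiv p) = L p - \<alpha> * J p - t * N p"
  using pearson_shift[of p] by (simp add: L_def J_def)

text \<open>Integration by parts is applied to x P_n^2. Only the leading term of x P_n' = n P_n +
  (lower degree) contributes, which gives the 2n, and the w/x integral is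
  \<open>a n\<close>.\<close>

lemma diag_eq: "diag n = 2 * real n + 1 + \<alpha> + a n"
proof -
  have "L (pderiv (pCons 0 (ortho n * ortho n))) = L (ortho n * ortho n) + 2 * L (ortho n * pCons 0 (pderiv (ortho n)))"
    using L_lin(4)[of 2 "pCons 0 (ortho n * pderiv (ortho n))"]
    by (simp add: pderiv_pCons pderiv_mult L_lin mult.commute two_mult_poly)
  also have "L (ortho n * pCons 0 (pderiv (ortho n))) = real n * h n"
  proof -
    have "coeff (pCons 0 (pderiv (ortho n))) n = real n"
      by (cases n) (simp_all add: coeff_pderiv)
    moreover have "degree (pCons 0 (pderiv (ortho n))) \<le> n"
      by (cases "n = 0") (auto simp: degree_pderiv intro: degree_pCons_le[THEN order_trans])
    ultimately show ?thesis by (simp only: L_ortho_top)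
  qed
  finally have "L (pCons 0 (ortho n * ortho n)) - \<alpha> * h n - t * J (ortho n * ortho n) = h n + 2 * (real n * h n)"
    unfolding L_pderiv by (simp add: L_def[of "ortho n * ortho n"] J_def h_def)
  then show ?thesis unfolding diag_def a_def using h_pos[of n] by (simp add: field_simps)
qed

text \<open>The recurrence for x P_n is integrated against P_n w/x. The left side becomes h_n, and
  the three terms on the right become \<open>c (Suc n)\<close>, \<open>a n\<close> and
  \<open>c n\<close>. For n = 0 the last term is absent, in agreement with
  \<open>c 0 = 0\<close>.\<close>

lemma a_diag: "a n * diag n = t + c n + c (Suc n)"
proof (cases n)
  case 0
  have "pCons 0 (1 :: real poly) = ortho (Suc 0) + smult (diag 0) 1"
    by (simp add: ortho_Suc_0 one_pCons)
  then have "L 1 = J (ortho (Suc 0)) + diag 0 * J 1" unfolding L_def by (simp only: J_lin)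
  then have "h 0 = J (ortho (Suc 0)) + diag 0 * J 1" by (simp add: h_def)
  then have "t * (diag 0 * J 1) = t * h 0 - t * J (ortho (Suc 0))" by (simp add: algebra_simps)
  then show ?thesis unfolding 0 a_def c_def using h_pos[of 0]
    by (simp add: field_simps)
next
  case (Suc m)
  have "pCons 0 (ortho n) = ortho (Suc n) + smult (diag n) (ortho n) + smult (h n / h m) (ortho m)"
    unfolding Suc ortho_Suc_Suc by simp
  then have "pCons 0 (ortho n * ortho n) = (ortho (Suc n) + smult (diag n) (ortho n) + smult (h n / h m) (ortho m)) * ortho n"
    by (metis mult_pCons_left smult_0_left add_0)
  then have "L (ortho n * ortho n) = J (ortho (Suc n) * ortho n) + diag n * J (ortho n * ortho n) + h n / h m * J (ortho n * ortho m)"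
    unfolding L_def by (simp add: J_lin distrib_left distrib_right mult.commute)
  moreover have "J (ortho (Suc n) * ortho n) = - c (Suc n) * h n / t" "J (ortho n * ortho m) = - c n * h m / t"
      "J (ortho n * ortho n) = a n * h n / t"
    using h_pos[of n] h_pos[of m] t by (simp_all add: c_def a_def Suc)
  ultimately have "h n = - c (Suc n) * h n / t + diag n * (a n * h n / t) - h n * c n / t"
    using h_pos[of m] by (simp add: h_def[of n])
  then have "(t * h n) * (a n * diag n) = (t * h n) * (t + c n + c (Suc n))"
    using h_pos[of n] t by (simp add: field_simps)
  then show ?thesis using h_pos[of n] t by (subst (asm) mult_left_cancel) auto
qed

text \<open>The integrals of \<open>P\<^sub>n P\<^sub>m x\<^sup>-\<^sup>2 w\<close> and \<open>P\<^sub>n\<^sup>2 x\<^sup>-\<^sup>2 w\<close> are known from integration by parts, and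
  expanding one factor at \<open>0\<close> relates them through the unknowns \<open>\<sigma> m\<close>, \<open>\<sigma> n\<close> and the derivatives
  at \<open>0\<close>; in the combination \<open>key\<close> these unknowns cancel.\<close>

lemma norm_ratio_a_sum: "h (Suc m) / h m * (a (Suc m) + a m) = real (Suc m) * t + (2 * real (Suc m) + \<alpha>) * c (Suc m)"
proof -
  define n where "n = Suc m"
  define X where "X = N (ortho n * ortho m)"
  define Y where "Y k = N (ortho k * ortho k)" for k
  have Y: "t * Y k = h k * (1 - \<alpha> * a k / t)" for k
  proof -
    have "L (pderiv (ortho k * ortho k)) = 2 * L (ortho k * pderiv (ortho k))"
      by (simp add: pderiv_mult L_lin mult.commute two_mult_poly)
    also have "L (ortho k * pderiv (ortho k)) = 0"
      by (cases "k = 0") (auto simp: L_ortho_orthogonal degree_pderiv L_lin pderiv_1)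
    finally have "t * Y k = h k - \<alpha> * J (ortho k * ortho k)"
      unfolding L_pderiv h_def[symmetric] Y_def by simp
    also have "\<dots> = h k * (1 - \<alpha> * a k / t)" unfolding a_def using t h_pos[of k] by (simp add: field_simps)
    finally show ?thesis .
  qed
  have X: "t * X = h m * (\<alpha> * c n / t - real n)"
  proof -
    have "L (pderiv (ortho n * ortho m)) = L (ortho m * pderiv (ortho n)) + L (ortho n * pderiv (ortho m))"
      by (simp add: pderiv_mult L_lin mult.commute add.commute)
    also have "L (ortho n * pderiv (ortho m)) = 0"
      by (rule L_ortho_orthogonal) (simp add: degree_pderiv n_def)
    also have "L (ortho m * pderiv (ortho n)) = real n * h m"
      by (subst L_ortho_top) (simp_all add: degree_pderiv n_def coeff_pderiv del: of_nat_Suc)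
    finally have "real n * h m = L (ortho n * ortho m) - \<alpha> * J (ortho n * ortho m) - t * X"
      unfolding L_pderiv X_def by simp
    moreover have "J (ortho n * ortho m) = - c n * h m / t"
      using h_pos[of m] t by (simp add: n_def c_def)
    moreover have "L (ortho n * ortho m) = 0" by (simp add: L_ortho_ortho n_def)
    ultimately show ?thesis by (simp add: field_simps)
  qed
  let ?p = "\<lambda>k. coeff (ortho k) 0" and ?q = "\<lambda>k. coeff (ortho k) 1"
  have X1: "X = ?p m * \<sigma> n + ?q m * \<nu> n" unfolding X_def by (simp add: N_ortho_mult n_def)
  have X2: "X = ?p n * \<sigma> m + ?q n * \<nu> m" unfolding X_def
    by (subst mult.commute) (simp add: N_ortho_mult n_def)
  have Yk: "Y k = ?p k * \<sigma> k + ?q k * \<nu> k" for k unfolding Y_def by (simp add: N_ortho_mult)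
  \<comment> \<open>\<open>X\<close> is expanded at a different factor in each summand; the cross
    terms then regroup into the expansions of \<open>Y n\<close> and \<open>Y m\<close>, which
    absorb every \<open>\<sigma>\<close>.\<close>
  have "X * (\<nu> m * ?p n + \<nu> n * ?p m) = \<nu> m * ?p n * (?p m * \<sigma> n + ?q m * \<nu> n) + \<nu> n * ?p m * (?p n * \<sigma> m + ?q n * \<nu> m)"
    unfolding X1[symmetric] X2[symmetric] by (simp add: algebra_simps)
  also have "\<dots> = ?p m * \<nu> m * Y n + ?p n * \<nu> n * Y m"
    unfolding Yk by (simp add: algebra_simps)
  finally have key: "X * (\<nu> m * ?p n + \<nu> n * ?p m) = ?p m * \<nu> m * Y n + ?p n * \<nu> n * Y m" .
  have am: "?p m * \<nu> m = a m * h m / t" and an: "?p n * \<nu> n = a n * h n / t"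
    and cn: "\<nu> n * ?p m = - c n * h m / t" and cn': "\<nu> m * ?p n = - (c n + t) * h m / t"
    using h_pos t a_eq[of m] a_eq[of n] c_eq[of m] c_eq'[of m]
    by (simp_all add: n_def field_simps less_imp_neq[THEN not_sym])
  have "(t * X) * (- (2 * c n + t) * h m / t) = t * (X * (\<nu> m * ?p n + \<nu> n * ?p m))"
    unfolding cn cn' using t by (simp add: field_simps)
  also have "\<dots> = (?p m * \<nu> m) * (t * Y n) + (?p n * \<nu> n) * (t * Y m)"
    unfolding key by (simp add: algebra_simps)
  finally have "(t * X) * (- (2 * c n + t) * h m / t) = a m * h m / t * (t * Y n) + a n * h n / t * (t * Y m)"
    unfolding am an .
  then have "h m * (\<alpha> * c n / t - real n) * (- (2 * c n + t) * h m / t)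
       = a m * h m / t * (h n * (1 - \<alpha> * a n / t)) + a n * h n / t * (h m * (1 - \<alpha> * a m / t))"
    unfolding X Y .
  then have "(\<alpha> * c n / t - real n) * (- (2 * c n + t))
       = h n / h m * (a n + a m) - 2 * \<alpha> / t * (h n / h m * a n * a m)"
    (is "?l = ?r")
  proof -
    assume eq: "h m * (\<alpha> * c n / t - real n) * (- (2 * c n + t) * h m / t)
       = a m * h m / t * (h n * (1 - \<alpha> * a n / t)) + a n * h n / t * (h m * (1 - \<alpha> * a m / t))"
    have "(h m * h m / t) * ?l = h m * (\<alpha> * c n / t - real n) * (- (2 * c n + t) * h m / t)"
      by (simp add: mult_ac)
    also have "\<dots> = (h m * h m / t) * ?r"
      unfolding eq using h_pos[of m] t by (simp add: divide_simps) (simp add: algebra_simps)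
    finally show ?thesis using h_pos[of m] t by (subst (asm) mult_left_cancel) auto
  qed
  \<comment> \<open>After \<open>c_mult\<close> replaces the product of the two \<open>a\<close>,
    the terms quadratic in c cancel, which leaves a right side linear in c.\<close>
  moreover have "(\<alpha> * c n / t - real n) * (- (2 * c n + t)) + 2 * \<alpha> / t * (c n * (c n + t))
       = real n * t + (2 * real n + \<alpha>) * c n"
    using t by (simp add: divide_simps) (simp add: algebra_simps)
  ultimately show ?thesis unfolding n_def c_mult by linarith
qed

text \<open>By \<open>c_mult\<close> either c > 0 or c < -t. In the second case the linear
  expression in \<open>norm_ratio_a_sum\<close> is at most -(m + 1 + \<alpha>) t, which is negative,
  although it equals a sum of positive terms.\<close>

lemma c_pos: "c (Suc m) > 0"
proof (rule ccontr)
  assume "\<not> c (Suc m) > 0"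
  have "h (Suc m) / h m * a (Suc m) * a m > 0" using a_pos h_pos by simp
  then have "c (Suc m) * (c (Suc m) + t) > 0" unfolding c_mult .
  then have "c (Suc m) < - t" using \<open>\<not> c (Suc m) > 0\<close> t by (auto simp: zero_less_mult_iff)
  then have "(2 * real (Suc m) + \<alpha>) * c (Suc m) \<le> (2 * real (Suc m) + \<alpha>) * (- t)"
    using \<alpha> by (intro mult_left_mono) auto
  then have "real (Suc m) * t + (2 * real (Suc m) + \<alpha>) * c (Suc m) \<le> - (real m + 1 + \<alpha>) * t"
    by (simp add: algebra_simps)
  also have "\<dots> \<le> 0" using \<alpha> t by (simp add: mult_nonpos_nonneg)
  finally have "h (Suc m) / h m * (a (Suc m) + a m) \<le> 0" unfolding norm_ratio_a_sum .
  moreover have "h (Suc m) / h m * (a (Suc m) + a m) > 0"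
    using a_pos[of m] a_pos[of "Suc m"] h_pos[of m] h_pos[of "Suc m"] by simp
  ultimately show False by linarith
qed

lemma c_system: "c (Suc m) * (c (Suc m) + t) * (a (Suc m) + a m)
    = (real (Suc m) * t + (2 * real (Suc m) + \<alpha>) * c (Suc m)) * a (Suc m) * a m"
  unfolding c_mult norm_ratio_a_sum[symmetric] by (simp add: mult_ac)

lemma coeff_ortho_subleading: "coeff (ortho (Suc n)) n = - (\<Sum>k\<le>n. diag k)"
proof (induction n)
  case 0 show ?case by (simp add: ortho_Suc_0)
next
  case (Suc n)
  then show ?case by (simp add: ortho_Suc_Suc coeff_eq_0)
qed

text \<open>At the first index n where the sequences could differ, the difference has some degree k
  < n. Testing it against the common polynomial of index k isolates its leading coefficient and
  shows that it vanishes. This is the uniqueness behind the definite description in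
  \<open>ortho_poly\<close>.\<close>

lemma ortho_unique:
  assumes P: "\<And>n. degree (P n) = n" "\<And>n. lead_coeff (P n) = 1"
    and orth: "\<And>j k. j \<noteq> k \<Longrightarrow> L (P j * P k) = 0"
  shows "P n = ortho n"
proof (induction n rule: less_induct)
  case (less n)
  define D where "D = P n - ortho n"
  show ?case
  proof (rule ccontr)
    assume "P n \<noteq> ortho n"
    then have D: "D \<noteq> 0" by (simp add: D_def)
    have "D = P n - smult (coeff (P n) n) (ortho n)" using P[of n] by (simp add: D_def)
    then have "degree D < n" using degree_reduce[of "P n" n] P(1)[of n] D by auto
    define k where "k = degree D"
    have k: "k < n" "ortho k = P k" using \<open>degree D < n\<close> less.IH[of k] by (simp_all add: k_def)
    have "L (ortho k * D) = L (P k * P n) - L (ortho k * ortho n)"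
      unfolding D_def right_diff_distrib L_lin k(2) ..
    also have "\<dots> = 0" using k orth[of k n] L_ortho_ortho[of k n] by simp
    finally have "coeff D k * h k = 0" using L_ortho_top[of D k] by (simp add: k_def)
    then show False using h_pos[of k] D by (simp add: k_def)
  qed
qed

end

section \<open>Integrals against the weight\<close>

lemma powr_exp_minus_integrable:
  assumes "s > (-1::real)"
  shows "set_integrable lborel {0<..} (\<lambda>x::real. x powr s * exp (- x))"
proof -
  have "((\<lambda>x. x powr (s + 1 - 1) / exp x) has_integral Gamma (s + 1)) {0..}"
    using assms by (intro Gamma_integral_real) simp
  then have "(\<lambda>x. x powr s * exp (- x)) integrable_on {0..}"
    by (auto simp: exp_minus field_simps)
  then have "(\<lambda>x. x powr s * exp (- x)) absolutely_integrable_on {0..}"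
    by (rule nonnegative_absolutely_integrable_1) auto
  then have "set_integrable lborel {0..} (\<lambda>x::real. x powr s * exp (- x))"
    unfolding set_integrable_def by (subst (asm) integrable_completion) auto
  then show ?thesis by (rule set_integrable_subset) auto
qed

text \<open>The factor exp(-t/x) absorbs every negative power of x: with u = t/x, the bound u/m
  \<le> exp(u/m) raised to the power m gives exp(-u) \<le> (m/u)^m. Choosing m with s + m > -1
  leaves a Gamma integrand as majorant.\<close>

lemma powr_exp_integrable:
  fixes s t :: real
  assumes t: "t > 0"
  shows "set_integrable lborel {0<..} (\<lambda>x. x powr s * exp (- x - t / x))"
proof -
  obtain m :: nat where m: "m > 0" "s + real m > -1"
  proof -
    obtain k :: nat where "real k > \<bar>s\<bar>" using reals_Archimedean2 by blast
    then show thesis by (intro that[of "Suc k"]) auto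
  qed
  have "set_integrable lborel {0<..} (\<lambda>x. (real m / t) ^ m * (x powr (s + real m) * exp (- x)))"
    by (intro set_integrable_mult_right powr_exp_minus_integrable m)
  then show ?thesis
  proof (rule set_integrable_bound)
    show "AE x in lborel. x \<in> {0<..} \<longrightarrow> norm (x powr s * exp (- x - t / x))
            \<le> norm ((real m / t) ^ m * (x powr (s + real m) * exp (- x)))"
    proof (intro AE_I2 impI)
      fix x :: real assume x: "x \<in> {0<..}"
      define u where "u = t / x"
      have u: "u > 0" using x t by (simp add: u_def)
      have "u / real m \<le> exp (u / real m)"
        using exp_ge_add_one_self[of "u / real m"] by linarith
      then have "(u / real m) ^ m \<le> exp (u / real m) ^ m"
        using u by (intro power_mono) auto
      also have "\<dots> = exp u" using m by (simp flip: exp_of_nat_mult)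
      finally have "exp (- u) \<le> (real m / u) ^ m"
        using u m by (simp add: exp_minus field_simps power_divide)
      also have "real m / u = real m / t * x" using x t by (simp add: u_def)
      also have "(real m / t * x) ^ m = (real m / t) ^ m * x ^ m" by (simp only: power_mult_distrib)
      finally have "x powr s * exp (- x) * exp (- u) \<le> x powr s * exp (- x) * ((real m / t) ^ m * x ^ m)"
        by (intro mult_left_mono) auto
      moreover have "exp (- x - t / x) = exp (- x) * exp (- u)" by (simp add: u_def exp_diff exp_minus field_simps)
      moreover have "x powr (s + real m) = x powr s * x ^ m" using x by (simp add: powr_add powr_realpow)
      ultimately show "norm (x powr s * exp (- x - t / x)) \<le> norm ((real m / t) ^ m * (x powr (s + real m) * exp (- x)))"
        using t x by (simp add: abs_mult mult_ac)
    qed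
  qed (auto simp: set_borel_measurable_def)
qed

lemma weight_moment_integrable:
  assumes t: "t > 0"
  shows "set_integrable lborel {0<..} (\<lambda>x. x ^ j * weight \<alpha> t x / x ^ m)"
proof -
  have "set_integrable lborel {0<..} (\<lambda>x. x powr (\<alpha> + real j - real m) * exp (- x - t / x))"
    by (rule powr_exp_integrable[OF t])
  also have "?this \<longleftrightarrow> ?thesis"
    by (intro set_integrable_cong)
       (auto simp: weight_def powr_add powr_diff powr_realpow field_simps)
  finally show ?thesis .
qed

lemma poly_weight_integrable:
  assumes t: "t > 0"
  shows "set_integrable lborel {0<..} (\<lambda>x. poly p x * weight \<alpha> t x / x ^ m)"
proof -
  have "set_integrable lborel {0<..} (\<lambda>x. coeff p i * (x ^ i * weight \<alpha> t x / x ^ m))" for i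
    by (intro set_integrable_mult_right weight_moment_integrable[OF t])
  then have "set_integrable lborel {0<..} (\<lambda>x. \<Sum>i\<le>degree p. coeff p i * (x ^ i * weight \<alpha> t x / x ^ m))"
    unfolding set_integrable_def scaleR_sum_right by (intro Bochner_Integration.integrable_sum)
  then show ?thesis
    by (simp add: poly_altdef sum_distrib_left sum_distrib_right sum_divide_distrib mult_ac)
qed

lemma tendsto_powr_exp_0:
  fixes s t :: real
  assumes "t > 0"
  shows "((\<lambda>x. x powr s * exp (- x - t / x)) \<longlongrightarrow> 0) at_top"
    and "((\<lambda>x. x powr s * exp (- x - t / x)) \<longlongrightarrow> 0) (at_right 0)"
  using assms by real_asymp+

lemma tendsto_poly_weight_0:
  assumes t: "t > 0"
  shows "((\<lambda>x. poly p x * weight \<alpha> t x) \<longlongrightarrow> 0) at_top"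
    and "((\<lambda>x. poly p x * weight \<alpha> t x) \<longlongrightarrow> 0) (at_right 0)"
proof -
  have eq: "poly p x * weight \<alpha> t x = (\<Sum>i\<le>degree p. coeff p i * (x powr (\<alpha> + real i) * exp (- x - t / x)))"
    if "x > 0" for x
    using that by (simp add: poly_altdef sum_distrib_right weight_def powr_add powr_realpow sum_distrib_left mult_ac)
  have *: "((\<lambda>x. \<Sum>i\<le>degree p. coeff p i * (x powr (\<alpha> + real i) * exp (- x - t / x))) \<longlongrightarrow> 0) F"
    if "\<And>s. ((\<lambda>x. x powr s * exp (- x - t / x)) \<longlongrightarrow> 0) F" for F
    by (intro tendsto_null_sum tendsto_mult_right_zero that)
  show "((\<lambda>x. poly p x * weight \<alpha> t x) \<longlongrightarrow> 0) at_top"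
    by (rule Lim_transform_eventually[OF *[OF tendsto_powr_exp_0(1)[OF t]]])
       (use eventually_gt_at_top[of 0] in \<open>eventually_elim, simp add: eq\<close>)
  show "((\<lambda>x. poly p x * weight \<alpha> t x) \<longlongrightarrow> 0) (at_right 0)"
    by (rule Lim_transform_eventually[OF *[OF tendsto_powr_exp_0(2)[OF t]]])
       (use eventually_at_right_less[of 0] in \<open>eventually_elim, simp add: eq\<close>)
qed

section \<open>The integral as an instance of the abstract functional\<close>

definition weighted_integral :: "real \<Rightarrow> real \<Rightarrow> real poly \<Rightarrow> real" where
  "weighted_integral \<alpha> t p = (LBINT x:{0<..}. poly p x * weight \<alpha> t x / x ^ 2)"

text \<open>If the integral of the nonnegative integrand were 0, then p would vanish almost
  everywhere on (0,1). As p has finitely many roots, this interval would be a null set.\<close>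

lemma weighted_integral_pos:
  assumes t: "t > 0" and p: "p \<noteq> 0" "\<And>x. x > 0 \<Longrightarrow> poly p x \<ge> 0"
  shows "weighted_integral \<alpha> t p > 0"
proof -
  let ?f = "\<lambda>x. indicator {0<..} x *\<^sub>R (poly p x * weight \<alpha> t x / x ^ 2)"
  have int: "integrable lborel ?f"
    using poly_weight_integrable[OF t, of p \<alpha> 2] by (simp add: set_integrable_def)
  have nonneg: "AE x in lborel. 0 \<le> ?f x"
    using p(2) by (auto simp: indicator_def weight_def)
  have "integral\<^sup>L lborel ?f \<noteq> 0"
  proof
    assume "integral\<^sup>L lborel ?f = 0"
    then have "AE x in lborel. ?f x = 0" using integral_nonneg_eq_0_iff_AE[OF int nonneg] by simp
    moreover have "AE x in lborel. x \<notin> {x. poly p x = 0}"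
      using poly_roots_finite[OF p(1)] by (intro AE_not_in finite_imp_null_set_lborel)
    ultimately have "AE x in lborel. x \<notin> {0<..<1::real}"
    proof eventually_elim
      case (elim x)
      then show ?case by (cases "x > 0") (auto simp: weight_def)
    qed
    then have "{0<..<1::real} \<in> null_sets lborel" by (subst AE_iff_null_sets) auto
    then show False by (auto simp: null_sets_def)
  qed
  moreover have "integral\<^sup>L lborel ?f \<ge> 0" by (rule integral_nonneg_AE[OF nonneg])
  ultimately show ?thesis by (simp add: weighted_integral_def set_lebesgue_integral_def)
qed

text \<open>The integrand is the derivative of p w. The boundary terms vanish: at 0 because of
  exp(-t/x), at infinity because of exp(-x).\<close>

lemma weighted_integral_pearson:
  assumes t: "t > 0"
  shows "weighted_integral \<alpha> t ([:0, 0, 1:] * pderiv p - [:-t, -\<alpha>, 1:] * p) = 0"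
proof -
  let ?q = "[:0, 0, 1:] * pderiv p - [:-t, -\<alpha>, 1:] * p"
  let ?F = "\<lambda>x. poly p x * weight \<alpha> t x"
  let ?f = "\<lambda>x. poly ?q x * weight \<alpha> t x / x ^ 2"
  have "(LBINT x=0..\<infinity>. ?f x) = 0 - 0"
  proof (rule interval_integral_FTC_integrable)
    fix x :: real assume "0 < ereal x"
    then have x: "x > 0" by simp
    show "(?F has_vector_derivative ?f x) (at x)"
      unfolding has_real_derivative_iff_has_vector_derivative[symmetric] weight_def
      using x by (auto intro!: derivative_eq_intros simp: powr_diff field_simps power2_eq_square)
    show "isCont ?f x" unfolding weight_def using x by (intro continuous_intros) auto
  next
    show "set_integrable lborel (einterval 0 \<infinity>) ?f"
      using poly_weight_integrable[OF t, of ?q \<alpha> 2] by (simp add: zero_ereal_def)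
    show "((?F \<circ> real_of_ereal) \<longlongrightarrow> 0) (at_right 0)"
      unfolding zero_ereal_def ereal_tendsto_simps using tendsto_poly_weight_0(2)[OF t] by simp
    show "((?F \<circ> real_of_ereal) \<longlongrightarrow> 0) (at_left \<infinity>)"
      unfolding ereal_tendsto_simps using tendsto_poly_weight_0(1)[OF t] by simp
  qed simp
  then show ?thesis
    by (simp add: weighted_integral_def zero_ereal_def interval_integral_to_infinity_eq)
qed

section \<open>Differentiating the moments under the integral sign\<close>

lemma has_real_derivative_quadratic_bound:
  fixes f :: "real \<Rightarrow> real"
  assumes "d > 0" and bound: "\<And>s. \<bar>s - t\<bar> < d \<Longrightarrow> \<bar>f s - f t - (s - t) * D\<bar> \<le> K * (s - t)\<^sup>2"
  shows "(f has_real_derivative D) (at t)"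
proof -
  have "((\<lambda>s. (f s - f t) / (s - t) - D) \<longlongrightarrow> 0) (at t)"
  proof (rule Lim_null_comparison)
    show "((\<lambda>s. K * \<bar>s - t\<bar>) \<longlongrightarrow> 0) (at t)" by (auto intro!: tendsto_eq_intros)
    show "\<forall>\<^sub>F s in at t. norm ((f s - f t) / (s - t) - D) \<le> K * \<bar>s - t\<bar>"
      unfolding eventually_at
    proof (intro exI[of _ d] conjI ballI impI)
      fix s assume "s \<noteq> t \<and> dist s t < d"
      then have s: "s \<noteq> t" "\<bar>s - t\<bar> < d" by (auto simp: dist_real_def)
      have "norm ((f s - f t) / (s - t) - D) = \<bar>f s - f t - (s - t) * D\<bar> / \<bar>s - t\<bar>"
        using s by (simp add: field_simps flip: abs_divide)
      also have "\<dots> \<le> K * (s - t)\<^sup>2 / \<bar>s - t\<bar>" using bound[OF s(2)] by (intro divide_right_mono) auto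
      also have "(s - t)\<^sup>2 = \<bar>s - t\<bar> * \<bar>s - t\<bar>" by (simp add: power2_eq_square)
      also have "K * (\<bar>s - t\<bar> * \<bar>s - t\<bar>) / \<bar>s - t\<bar> = K * \<bar>s - t\<bar>"
        using s by (subst mult.assoc[symmetric], intro nonzero_mult_div_cancel_right) simp
      finally show "norm ((f s - f t) / (s - t) - D) \<le> K * \<bar>s - t\<bar>" .
    qed (use assms in auto)
  qed
  then show ?thesis unfolding has_field_derivative_iff by (simp add: LIM_zero_iff)
qed

text \<open>Both signs of y rest on \<open>exp y - 1 \<le> y * exp y\<close>. The maximum gives one
  bound for s on either side of t.\<close>

lemma exp_minus_one_minus_le:
  fixes y :: real
  shows "exp y - 1 - y \<le> y\<^sup>2 * max 1 (exp y)"
proof -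
  have *: "exp y - 1 \<le> y * exp y"
  proof -
    have "exp y * (1 - y) \<le> exp y * exp (- y)"
      using exp_ge_add_one_self[of "- y"] by (intro mult_left_mono) auto
    then show ?thesis by (simp add: algebra_simps flip: exp_add)
  qed
  show ?thesis
  proof (cases "y \<ge> 0")
    case True
    have "exp y - 1 - y \<le> y * (exp y - 1)" using * by (simp add: algebra_simps)
    also have "\<dots> \<le> y * (y * exp y)" using * True by (intro mult_left_mono)
    also have "\<dots> = y\<^sup>2 * exp y" by (simp add: power2_eq_square)
    also have "\<dots> \<le> y\<^sup>2 * max 1 (exp y)" by (intro mult_left_mono) auto
    finally show ?thesis .
  next
    case False
    have "exp y - 1 - y \<le> (- y) * (1 - exp y)" using * by (simp add: algebra_simps)
    also have "\<dots> \<le> (- y) * (- y)" using exp_ge_add_one_self[of y] False by (intro mult_left_mono) linarith+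
    also have "\<dots> \<le> y\<^sup>2 * max 1 (exp y)" by (simp add: power2_eq_square mult_le_cancel_left1)
    finally show ?thesis .
  qed
qed

text \<open>The weight at s is the weight at t times exp y with y = -(s - t)/x. The weight decreases
  in its parameter, so the one at t/2 dominates those at s and t and yields a majorant independent
  of s.\<close>

lemma weight_taylor:
  assumes "x > 0" "t > 0" "s > t / 2"
  shows "\<bar>weight \<alpha> s x - weight \<alpha> t x + (s - t) * (weight \<alpha> t x / x)\<bar> \<le> (s - t)\<^sup>2 * (weight \<alpha> (t / 2) x / x\<^sup>2)"
proof -
  define y where "y = - (s - t) / x"
  have s: "weight \<alpha> s x = weight \<alpha> t x * exp y"
    by (simp add: weight_def y_def diff_divide_distrib flip: exp_add)
  have w: "weight \<alpha> t x \<ge> 0" by (simp add: weight_def)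
  have m: "weight \<alpha> t x * max 1 (exp y) \<le> weight \<alpha> (t / 2) x"
  proof -
    have "weight \<alpha> r x \<le> weight \<alpha> (t / 2) x" if "r \<ge> t / 2" for r
      unfolding weight_def using that assms by (intro mult_left_mono) (auto simp: field_simps)
    from this[of t] this[of s] show ?thesis using assms by (simp add: s max_def)
  qed
  have "weight \<alpha> s x - weight \<alpha> t x + (s - t) * (weight \<alpha> t x / x) = weight \<alpha> t x * (exp y - 1 - y)"
    unfolding s y_def using assms by (simp add: field_simps)
  moreover have "0 \<le> weight \<alpha> t x * (exp y - 1 - y)"
    using w exp_ge_add_one_self[of y] by (intro mult_nonneg_nonneg) linarith+
  moreover have "weight \<alpha> t x * (exp y - 1 - y) \<le> weight \<alpha> t x * (y\<^sup>2 * max 1 (exp y))"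
    using w exp_minus_one_minus_le by (intro mult_left_mono)
  moreover have "\<dots> = y\<^sup>2 * (weight \<alpha> t x * max 1 (exp y))" by simp
  moreover have "\<dots> \<le> y\<^sup>2 * weight \<alpha> (t / 2) x" using m by (intro mult_left_mono) auto
  moreover have "\<dots> = (s - t)\<^sup>2 * (weight \<alpha> (t / 2) x / x\<^sup>2)"
    by (simp add: y_def power_divide power2_commute)
  ultimately show ?thesis by linarith
qed

text \<open>Integrating the pointwise bound of \<open>weight_taylor\<close> gives a remainder
  quadratic in s - t, with a constant uniform for |s - t| < t/2; this does the work of dominated
  convergence.\<close>

lemma moment_has_derivative:
  assumes t: "t > 0"
  shows "((\<lambda>s. moment \<alpha> s j) has_real_derivative - (LBINT x:{0<..}. x ^ j * weight \<alpha> t x / x)) (at t)"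
proof (rule has_real_derivative_quadratic_bound)
  let ?K = "LBINT x:{0<..}. x ^ j * weight \<alpha> (t / 2) x / x ^ 2"
  fix s assume "\<bar>s - t\<bar> < t / 2"
  then have s: "s > t / 2" "s > 0" using t by linarith+
  note int0 = weight_moment_integrable[of _ j \<alpha> 0, simplified]
  note int1 = weight_moment_integrable[of _ j \<alpha> 1, simplified]
  have int2: "set_integrable lborel {0<..} (\<lambda>x. (s - t)\<^sup>2 * (x ^ j * weight \<alpha> (t / 2) x / x\<^sup>2))"
    using t by (intro set_integrable_mult_right weight_moment_integrable) simp
  let ?g = "\<lambda>x. x ^ j * weight \<alpha> s x - x ^ j * weight \<alpha> t x + (s - t) * (x ^ j * weight \<alpha> t x / x)"
  have intg: "set_integrable lborel {0<..} ?g"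
    by (intro set_integral_add(1) set_integral_diff(1) set_integrable_mult_right int0 int1 s t)
  have "(LBINT x:{0<..}. ?g x) = (LBINT x:{0<..}. x ^ j * weight \<alpha> s x - x ^ j * weight \<alpha> t x)
      + (LBINT x:{0<..}. (s - t) * (x ^ j * weight \<alpha> t x / x))"
    by (intro set_integral_add(2) set_integral_diff(1) set_integrable_mult_right int0 int1 s t)
  also have "(LBINT x:{0<..}. x ^ j * weight \<alpha> s x - x ^ j * weight \<alpha> t x) = moment \<alpha> s j - moment \<alpha> t j"
    unfolding moment_def by (intro set_integral_diff(2) int0 s t)
  also have "(LBINT x:{0<..}. (s - t) * (x ^ j * weight \<alpha> t x / x))
      = (s - t) * (LBINT x:{0<..}. x ^ j * weight \<alpha> t x / x)"
    by (rule set_integral_mult_right)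
  finally have eq: "moment \<alpha> s j - moment \<alpha> t j - (s - t) * - (LBINT x:{0<..}. x ^ j * weight \<alpha> t x / x)
      = (LBINT x:{0<..}. ?g x)"
    by linarith
  have "\<bar>LBINT x:{0<..}. ?g x\<bar> \<le> (LBINT x:{0<..}. (s - t)\<^sup>2 * (x ^ j * weight \<alpha> (t / 2) x / x ^ 2))"
  proof -
    have "\<bar>LBINT x:{0<..}. ?g x\<bar> \<le> (LBINT x:{0<..}. \<bar>?g x\<bar>)"
      using set_integral_norm_bound[OF intg] by (simp only: real_norm_def)
    also have "\<dots> \<le> (LBINT x:{0<..}. (s - t)\<^sup>2 * (x ^ j * weight \<alpha> (t / 2) x / x ^ 2))"
    proof (rule set_integral_mono[OF set_integrable_abs[OF intg] int2])
      fix x :: real assume "x \<in> {0<..}"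
      then have x: "x > 0" by simp
      have "?g x = x ^ j * (weight \<alpha> s x - weight \<alpha> t x + (s - t) * (weight \<alpha> t x / x))"
        unfolding times_divide_eq_right[symmetric] by (simp only: distrib_left right_diff_distrib mult.left_commute)
      then have "\<bar>?g x\<bar> = x ^ j * \<bar>weight \<alpha> s x - weight \<alpha> t x + (s - t) * (weight \<alpha> t x / x)\<bar>"
        using x by (simp add: abs_mult)
      also have "\<dots> \<le> x ^ j * ((s - t)\<^sup>2 * (weight \<alpha> (t / 2) x / x\<^sup>2))"
        using x weight_taylor[OF x t s(1)] by (intro mult_left_mono) auto
      finally show "\<bar>?g x\<bar> \<le> (s - t)\<^sup>2 * (x ^ j * weight \<alpha> (t / 2) x / x ^ 2)"
        by (simp only: mult.left_commute times_divide_eq_right)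
    qed
    finally show ?thesis .
  qed
  then show "\<bar>moment \<alpha> s j - moment \<alpha> t j - (s - t) * - (LBINT x:{0<..}. x ^ j * weight \<alpha> t x / x)\<bar> \<le> ?K * (s - t)\<^sup>2"
    unfolding eq set_integral_mult_right by (simp only: mult.commute)
qed (use t in simp)

section \<open>Differentiating a determinant\<close>

text \<open>The matrix is U M U^T with U unitriangular, as arises when monomials are replaced by
  monic polynomials of the same degrees.\<close>

lemma det_congruence_unitriangular:
  fixes u :: "nat \<Rightarrow> nat \<Rightarrow> real" and M :: "nat \<Rightarrow> nat \<Rightarrow> real"
  assumes diag: "\<And>j. u j j = 1" and tri: "\<And>j i. j < i \<Longrightarrow> u j i = 0"
  shows "Determinant.det (Matrix.mat n n (\<lambda>(j, k). \<Sum>i<n. \<Sum>l<n. u j i * u k l * M i l))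
       = Determinant.det (Matrix.mat n n (\<lambda>(i, l). M i l))"
proof -
  define U where "U = Matrix.mat n n (\<lambda>(j, i). u j i)"
  define A where "A = Matrix.mat n n (\<lambda>(i, l). M i l)"
  have carrier: "U \<in> carrier_mat n n" "A \<in> carrier_mat n n" "transpose_mat U \<in> carrier_mat n n"
    by (simp_all add: U_def A_def)
  have det_U: "Determinant.det U = 1"
  proof -
    have "Determinant.det U = prod_list (diag_mat U)"
      by (rule det_lower_triangular[OF _ carrier(1)]) (simp add: U_def tri)
    also have "\<dots> = 1"
      unfolding prod_list_diag_prod by (rule prod.neutral) (simp add: U_def diag)
    finally show ?thesis .
  qed
  have "U * (A * transpose_mat U) = Matrix.mat n n (\<lambda>(j, k). \<Sum>i<n. \<Sum>l<n. u j i * u k l * M i l)"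
    by (rule eq_matI)
       (auto simp: U_def A_def scalar_prod_def sum_distrib_left atLeast0LessThan mult_ac intro!: sum.cong)
  moreover have "Determinant.det (U * (A * transpose_mat U)) = Determinant.det A"
    using carrier det_U by (simp add: det_mult[of _ n] det_transpose[of _ n])
  ultimately show ?thesis by (simp add: A_def)
qed

text \<open>In the Leibniz formula the product rule omits one factor per summand. A permutation
  other than the identity moves at least two points, so an off-diagonal zero always remains.\<close>

lemma det_has_derivative_at_diagonal:
  fixes f :: "real \<Rightarrow> nat \<Rightarrow> nat \<Rightarrow> real"
  assumes deriv: "\<And>j k. ((\<lambda>s. f s j k) has_real_derivative f' j k) (at t)"
    and diagonal: "\<And>j k. j < n \<Longrightarrow> k < n \<Longrightarrow> j \<noteq> k \<Longrightarrow> f t j k = 0"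
  shows "((\<lambda>s. Determinant.det (Matrix.mat n n (\<lambda>(j, k). f s j k))) has_real_derivative
           (\<Sum>k<n. f' k k * (\<Prod>j\<in>{..<n} - {k}. f t j j))) (at t)"
proof -
  let ?S = "{p. p permutes {0..<n}}"
  define g where "g p = (\<Sum>i<n. f' i (p i) * (\<Prod>j\<in>{..<n} - {i}. f t j (p j)))" for p
  have "((\<lambda>s. \<Sum>p\<in>?S. signof p * (\<Prod>i<n. f s i (p i))) has_real_derivative (\<Sum>p\<in>?S. signof p * g p)) (at t)"
    unfolding g_def by (intro DERIV_sum DERIV_cmult has_field_derivative_prod deriv)
  moreover have "Determinant.det (Matrix.mat n n (\<lambda>(j, k). f s j k)) = (\<Sum>p\<in>?S. signof p * (\<Prod>i<n. f s i (p i)))" for s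
    by (subst det_def'[of _ n])
       (auto intro!: sum.cong prod.cong simp: atLeast0LessThan dest: permutes_in_image)
  moreover have "(\<Sum>p\<in>?S. signof p * g p) = (\<Sum>p\<in>{id}. signof p * g p)"
  proof (rule sum.mono_neutral_right)
    show "\<forall>p\<in>?S - {id}. signof p * g p = 0"
    proof
      fix p assume "p \<in> ?S - {id}"
      then have p: "p permutes {0..<n}" "p \<noteq> id" by auto
      then obtain b where b: "p b \<noteq> b" by (metis eq_id_iff ext)
      \<comment> \<open>The image of a moved point is a second moved point; it serves when the
        omitted factor is the one at b.\<close>
      have b': "p (p b) \<noteq> p b" using b permutes_inj[OF p(1)] by (metis injD)
      have mem: "b < n" "p b < n" using b b' p(1) by (auto simp: permutes_def)
      have zero: "(\<Prod>j\<in>{..<n} - {i}. f t j (p j)) = 0" for i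
      proof -
        obtain j where "j \<in> {..<n} - {i}" "p j \<noteq> j"
          using b b' mem by (metis DiffI lessThan_iff singletonD)
        moreover from this have "p j < n" using permutes_in_image[OF p(1), of j] by simp
        ultimately show ?thesis using diagonal[of j "p j"] by (intro prod_zero) auto
      qed
      show "signof p * g p = 0" unfolding g_def zero by simp
    qed
  qed (auto simp: finite_permutations permutes_id)
  ultimately show ?thesis by (simp add: g_def)
qed

section \<open>Asymptotics of the recurrence system\<close>

lemma bigo_one_intros:
  fixes f g :: "real \<Rightarrow> real"
  shows "(\<lambda>_. c::real) \<in> O[F](\<lambda>_. 1::real)"
    and "f \<in> O[F](\<lambda>_. 1) \<Longrightarrow> g \<in> O[F](\<lambda>_. 1) \<Longrightarrow> (\<lambda>x. f x + g x) \<in> O[F](\<lambda>_. 1)"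
    and "f \<in> O[F](\<lambda>_. 1) \<Longrightarrow> g \<in> O[F](\<lambda>_. 1) \<Longrightarrow> (\<lambda>x. f x - g x) \<in> O[F](\<lambda>_. 1)"
    and "f \<in> O[F](\<lambda>_. 1) \<Longrightarrow> g \<in> O[F](\<lambda>_. 1) \<Longrightarrow> (\<lambda>x. f x * g x) \<in> O[F](\<lambda>_. 1)"
  using landau_o.big.mult[of f F "\<lambda>_. 1" g "\<lambda>_. 1"]
  by (simp_all add: sum_in_bigo)

text \<open>Since k + \<mu> e C \<le> M (1 + e C), the factor 1 + e C cancels and C \<le> M A A' /
  (A + A') remains.\<close>

lemma scaled_system_bounded:
  fixes A A' C e k M \<mu> :: real
  assumes "e > 0" "A > 0" "A' > 0" "C \<ge> 0" "\<mu> \<ge> 0" "k \<ge> 0" and M: "k \<le> M" "\<mu> \<le> M"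
    and eq: "C * (1 + e * C) * (A + A') = (k + \<mu> * e * C) * A * A'"
  shows "C \<le> M * A" "C \<le> M * A'"
proof -
  have M0: "M \<ge> 0" using assms by simp
  have key: "C \<le> M * X" if X: "X > 0" and Y: "Y > 0"
    and e2: "C * (1 + e * C) * (X + Y) = (k + \<mu> * e * C) * X * Y" for X Y
  proof -
    have p: "1 + e * C > 0" using assms by (simp add: add_pos_nonneg)
    have "k + \<mu> * e * C \<le> M + M * (e * C)"
      using mult_right_mono[OF M(2), of "e * C"] assms by (auto simp: algebra_simps intro: add_mono)
    then have "k + \<mu> * (e * C) \<le> M * (1 + e * C)" by (simp add: algebra_simps)
    then have "(k + \<mu> * e * C) * (X * Y) \<le> (M * (1 + e * C)) * (X * Y)"
      using X Y by (intro mult_right_mono) (auto simp: algebra_simps)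
    moreover have "(M * (1 + e * C)) * (X * Y) \<le> (M * (1 + e * C)) * (X * (X + Y))"
      using X Y p M0 by (intro mult_left_mono) auto
    ultimately have "C * ((1 + e * C) * (X + Y)) \<le> (M * X) * ((1 + e * C) * (X + Y))"
      using e2 by (simp add: mult_ac)
    then show ?thesis using p X Y by (rule_tac mult_right_le_imp_le) auto
  qed
  show "C \<le> M * A" by (rule key[OF assms(2,3) eq])
  show "C \<le> M * A'" by (rule key[OF assms(3,2)]) (use eq in \<open>simp add: algebra_simps\<close>)
qed

text \<open>The bound 1/4 on e M makes the right side at most 1 + A/2, whereas A > 2 would force A^2
  > 2 A on the left.\<close>

lemma scaled_root_bounded:
  fixes A e :: real
  assumes "A > 0" "e * M \<le> 1 / 4" "\<kappa> \<ge> 0" "e > 0" "C \<le> M * A" "D \<le> M * A"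
    and eq: "A\<^sup>2 + \<kappa> * e * A = 1 + e * (C + D)"
  shows "A \<le> 2"
proof (rule ccontr)
  assume "\<not> A \<le> 2"
  have "e * (C + D) \<le> e * (2 * (M * A))" using assms by (intro mult_left_mono) auto
  also have "\<dots> = (e * M) * (2 * A)" by simp
  also have "\<dots> \<le> (1 / 4) * (2 * A)" using assms by (intro mult_right_mono) auto
  finally have "e * (C + D) \<le> A / 2" by simp
  moreover have "\<kappa> * e * A \<ge> 0" using assms by simp
  ultimately have "A\<^sup>2 \<le> 1 + A / 2" using eq by linarith
  moreover have "A\<^sup>2 > 2 * A" using \<open>\<not> A \<le> 2\<close> by (simp add: power2_eq_square)
  ultimately show False using \<open>\<not> A \<le> 2\<close> by auto
qed

text \<open>Below, \<open>A = a\<^sub>k / \<surd>t\<close>, \<open>C = c\<^sub>k / \<surd>t\<close>, \<open>e = 1 / \<surd>t\<close>. Each lemma writes the next correction term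
  as a polynomial in quantities that are already known to be bounded.\<close>

lemma A_first_correction:
  fixes A :: real
  assumes "e > 0" "A > 0" and "A\<^sup>2 + \<kappa> * e * A = 1 + e * (C + D)"
  shows "(A - 1) / e = (C + D - \<kappa> * A) * inverse (A + 1)"
  using assms by (simp add: field_simps power2_eq_square)

lemma C_first_correction:
  fixes A :: real
  assumes "e > 0" and "A = 1 + e * a" "A' = 1 + e * a'"
   and eq: "C * (1 + e * C) * (A + A') = (k + \<mu> * e * C) * A * A'"
  shows "(C - k / 2) / e = (k * (a + a') + k * e * a * a' + \<mu> * C * A * A' - C * (a + a') - C * C * (A + A')) / 2"
proof -
  define R where "R = k * (a + a') + k * e * a * a' + \<mu> * C * A * A' - C * (a + a') - C * C * (A + A')"
  have "2 * C - k = e * R"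
    using eq unfolding R_def assms(2,3) by (simp add: algebra_simps)
  then have "C - k / 2 = e * (R / 2)" by simp
  then show ?thesis unfolding R_def using assms(1) by (metis nonzero_mult_div_cancel_left less_irrefl)
qed

text \<open>The limits k/2 and (k + 1)/2 of the neighbouring C enter at order e, where the equation
  reads 2 x = k/2 + (k + 1)/2 - \<kappa> up to O(e).\<close>

lemma A_second_correction:
  fixes A :: real
  assumes "e > 0" "A > 0" and "A = 1 + e * x" "C = k / 2 + e * y" "D = (k + 1) / 2 + e * z"
    and eq: "A\<^sup>2 + \<kappa> * e * A = 1 + e * (C + D)"
  shows "(x - ((2 * k + 1) / 2 - \<kappa>) / 2) / e = (y + z - \<kappa> * x - x * x) / 2"
proof -
  have "e * (e * x\<^sup>2 + 2 * x) = e * ((2 * k + 1) / 2 - \<kappa> + e * (y + z - \<kappa> * x))"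
    using eq unfolding assms(3-5) by (simp add: algebra_simps power2_eq_square add_divide_distrib)
  then have "e * x\<^sup>2 + 2 * x = (2 * k + 1) / 2 - \<kappa> + e * (y + z - \<kappa> * x)"
    using assms(1) mult_left_cancel[of e] by blast
  then have "2 * x = (2 * k + 1) / 2 - \<kappa> + e * (y + z - \<kappa> * x - x * x)"
    by (simp add: algebra_simps power2_eq_square)
  then have "x - ((2 * k + 1) / 2 - \<kappa>) / 2 = e * ((y + z - \<kappa> * x - x * x) / 2)"
    by (simp add: algebra_simps add_divide_distrib diff_divide_distrib)
  then show ?thesis using assms(1) by (metis nonzero_mult_div_cancel_left less_irrefl)
qed

text \<open>The point is that C has no correction of order e: the constant part of 2 y is (k/2)(p +
  p') + \<mu> k/2 - k^2/2, and the given values of p + p' and \<mu> make it 0.\<close>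

lemma C_second_correction:
  fixes A :: real
  assumes e: "e > 0" and A: "A = 1 + e * a" "A' = 1 + e * a'" and C: "C = k / 2 + e * y"
    and a: "a = p + e * b" "a' = p' + e * b'" and p: "p + p' = - (k + \<alpha>)" and \<mu>: "\<mu> = 2 * k + \<alpha>"
    and eq: "y = (k * (a + a') + k * e * a * a' + \<mu> * C * A * A' - C * (a + a') - C * C * (A + A')) / 2"
  shows "y / e = ((k / 2) * (b + b') + k * a * a' + \<mu> * (y * A * A' + (k / 2) * (a + a' + e * a * a'))
           - y * (a + a') - y * (C + k / 2) * (A + A') - (k * k / 4) * (a + a')) / 2"
proof -
  define R where "R = (k / 2) * (b + b') + k * a * a' + \<mu> * (y * A * A' + (k / 2) * (a + a' + e * a * a'))
           - y * (a + a') - y * (C + k / 2) * (A + A') - (k * k / 4) * (a + a')"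
  have sum: "a + a' = - (k + \<alpha>) + e * (b + b')" using a p by (simp add: algebra_simps)
  have *: "(k / 2) * (a + a') = - (k / 2) * (k + \<alpha>) + (k / 2) * (e * (b + b'))"
    unfolding sum by (simp add: field_simps)
  have "2 * y = k * (a + a') + k * e * a * a' + \<mu> * C * A * A' - C * (a + a') - C * C * (A + A')"
    by (subst eq) simp
  also have "\<dots> = (k / 2) * (a + a') + k * e * a * a' + \<mu> * (k / 2 + e * y) * (1 + e * a) * (1 + e * a')
      - e * y * (a + a') - (k * k / 4) * (2 + e * (a + a')) - e * y * (C + k / 2) * (A + A')"
    unfolding C A by (simp add: field_simps)
  also have "\<dots> = e * R"
    unfolding * R_def A \<mu> C by (simp add: field_simps)
  finally have "y = e * (R / 2)" by simp
  then show ?thesis unfolding R_def using e by (metis nonzero_mult_div_cancel_left less_irrefl)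
qed

text \<open>As y and z are of order e, the limit of b depends on p alone: 2 b = -\<kappa> p - p^2 up
  to O(e).\<close>

lemma A_third_correction:
  fixes x :: real
  assumes "e > 0" and "x = p + e * b" "y = e * u" "z = e * v" and "b = (y + z - \<kappa> * x - x * x) / 2"
  shows "(b - (- p * (\<kappa> + p) / 2)) / e = (u + v - \<kappa> * b - b * (x + p)) / 2"
proof -
  have "2 * b = e * u + e * v - \<kappa> * x - x * x"
    using assms(3-5) by simp
  moreover have "e * (u + v - \<kappa> * b - b * (x + p)) - p * (\<kappa> + p) = e * u + e * v - \<kappa> * x - x * x"
    unfolding assms(2) by (simp add: algebra_simps)
  ultimately have "2 * b + p * (\<kappa> + p) = e * (u + v - \<kappa> * b - b * (x + p))"
    by linarith
  then have "b - (- p * (\<kappa> + p) / 2) = e * ((u + v - \<kappa> * b - b * (x + p)) / 2)"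
    by simp
  then show ?thesis using assms(1) by (metis nonzero_mult_div_cancel_left less_irrefl)
qed

text \<open>Boundedness is obtained order by order for all k together, in the sequence
  \<open>A1\<close>, \<open>C1\<close>, \<open>A2\<close>, \<open>C2\<close>, \<open>A3\<close>,
  because each correction at k involves neighbouring indices of the preceding ones.\<close>

lemma recurrence_asymptotics:
  fixes a c :: "nat \<Rightarrow> real \<Rightarrow> real" and \<alpha> :: real
  assumes \<alpha>: "\<alpha> > -1"
    and a_pos: "\<And>k t. t > 0 \<Longrightarrow> a k t > 0"
    and c_0: "\<And>t. t > 0 \<Longrightarrow> c 0 t = 0"
    and c_nonneg: "\<And>k t. t > 0 \<Longrightarrow> c k t \<ge> 0"
    and eq_a: "\<And>k t. t > 0 \<Longrightarrow> (a k t)\<^sup>2 + (2 * real k + 1 + \<alpha>) * a k t = t + c k t + c (Suc k) t"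
    and eq_c: "\<And>k t. t > 0 \<Longrightarrow> c (Suc k) t * (c (Suc k) t + t) * (a (Suc k) t + a k t)
                 = (real (Suc k) * t + (2 * real (Suc k) + \<alpha>) * c (Suc k) t) * a (Suc k) t * a k t"
  shows "(\<lambda>t. a k t - (sqrt t - (2 * real k + 1 + 2 * \<alpha>) / 4
            + (2 * real k + 1 + 2 * \<alpha>) * (6 * real k + 3 + 2 * \<alpha>) / (32 * sqrt t)))
           \<in> O[at_top](\<lambda>t. 1 / t)"
proof -
  define e where "e = (\<lambda>t. 1 / sqrt t)"
  define A where "A = (\<lambda>k t. a k t * e t)"
  define C where "C = (\<lambda>k t. c k t * e t)"
  define \<kappa> where "\<kappa> = (\<lambda>k. 2 * real k + 1 + \<alpha>)"
  define \<mu> where "\<mu> = (\<lambda>k. 2 * real k + \<alpha>)"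
  define A1 where "A1 = (\<lambda>k t. (A k t - 1) / e t)"
  define C1 where "C1 = (\<lambda>k t. (C k t - real k / 2) / e t)"
  \<comment> \<open>The limit of \<open>A1 k\<close> dictated by \<open>A_second_correction\<close>,
    equal to -(2k + 1 + 2\<alpha>)/4.\<close>
  define p where "p = (\<lambda>k. ((2 * real k + 1) / 2 - \<kappa> k) / 2)"
  define A2 where "A2 = (\<lambda>k t. (A1 k t - p k) / e t)"
  define C2 where "C2 = (\<lambda>k t. C1 k t / e t)"
  define A3 where "A3 = (\<lambda>k t. (A2 k t - (- p k * (\<kappa> k + p k) / 2)) / e t)"
  have e: "e t > 0" "t * e t ^ 2 = 1" "sqrt t = t * e t" if "t > 0" for t
    using that by (auto simp: e_def power_divide real_div_sqrt)
  have A_pos: "A k t > 0" if "t > 0" for k t using that a_pos e by (simp add: A_def)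
  have C_nonneg: "C k t \<ge> 0" if "t > 0" for k t using that c_nonneg e by (simp add: C_def less_imp_le)
  have EA: "(A k t)\<^sup>2 + \<kappa> k * e t * A k t = 1 + e t * (C k t + C (Suc k) t)" if t: "t > 0" for k t
  proof -
    have "(A k t)\<^sup>2 + \<kappa> k * e t * A k t = (e t)\<^sup>2 * ((a k t)\<^sup>2 + \<kappa> k * a k t)"
      by (simp add: A_def power2_eq_square algebra_simps)
    also have "\<dots> = t * (e t)\<^sup>2 + e t * (C k t + C (Suc k) t)"
      unfolding \<kappa>_def eq_a[OF t] by (simp add: C_def power2_eq_square algebra_simps)
    finally show ?thesis using e[OF t] by simp
  qed
  have EC: "C (Suc k) t * (1 + e t * C (Suc k) t) * (A (Suc k) t + A k t)
      = (real (Suc k) + \<mu> (Suc k) * e t * C (Suc k) t) * A (Suc k) t * A k t" if t: "t > 0" for k t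
  proof -
    \<comment> \<open>The weight e^4 is one e for c, one for the sum of the two a, and e^2 for c +
      t, whose t turns into t e^2 = 1.\<close>
    have "C (Suc k) t * (t * e t ^ 2 + e t * C (Suc k) t) * (A (Suc k) t + A k t)
      = e t ^ 4 * (c (Suc k) t * (c (Suc k) t + t) * (a (Suc k) t + a k t))"
      by (simp add: C_def A_def power2_eq_square algebra_simps power4_eq_xxxx)
    also have "\<dots> = (real (Suc k) * (t * e t ^ 2) + \<mu> (Suc k) * e t * C (Suc k) t) * A (Suc k) t * A k t"
      unfolding eq_c[OF t] \<mu>_def
      by (simp add: C_def A_def power2_eq_square algebra_simps power4_eq_xxxx)
    finally show ?thesis using e[OF t] by simp
  qed
  have C_0: "C 0 t = 0" if "t > 0" for t using c_0[OF that] by (simp add: C_def)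
  have \<mu>_nonneg: "\<mu> (Suc k) \<ge> 0" for k using \<alpha> by (simp add: \<mu>_def)
  have C_le: "C (Suc k) t \<le> (2 * real (Suc k) + \<bar>\<alpha>\<bar>) * A (Suc k) t"
    "C (Suc k) t \<le> (2 * real (Suc k) + \<bar>\<alpha>\<bar>) * A k t" if t: "t > 0" for k t
    using scaled_system_bounded[OF e(1)[OF t] A_pos[OF t] A_pos[OF t] C_nonneg[OF t] \<mu>_nonneg _ _ _ EC[OF t],
       where M = "2 * real (Suc k) + \<bar>\<alpha>\<bar>"]
    by (auto simp: \<mu>_def)
  have A_bd: "\<forall>\<^sub>F t in at_top. A k t \<le> 2" for k
  proof -
    \<comment> \<open>The constant for index \<open>Suc k\<close> also dominates the one for k, so a
      single \<open>M\<close> bounds \<open>C k\<close> and \<open>C (Suc k)\<close> by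
      \<open>A k\<close>. The threshold 16 M^2 for t is what \<open>e t * M \<le> 1 / 4\<close>
      amounts to.\<close>
    define M where "M = 2 * real (Suc k) + \<bar>\<alpha>\<bar>"
    have "\<forall>\<^sub>F t in at_top. t > (16 * M\<^sup>2 :: real) \<and> t > 0"
      by (intro eventually_conj eventually_gt_at_top)
    then show ?thesis
    proof eventually_elim
      case (elim t)
      have "C k t \<le> M * A k t"
      proof (cases k)
        case 0 then show ?thesis using elim C_0 A_pos[of t k] by (simp add: M_def)
      next
        case (Suc j)
        then have "C k t \<le> (2 * real k + \<bar>\<alpha>\<bar>) * A k t" using C_le(1)[of t j] elim by simp
        also have "\<dots> \<le> M * A k t" using A_pos[of t k] elim by (intro mult_right_mono) (auto simp: M_def)
        finally show ?thesis .
      qed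
      moreover have "C (Suc k) t \<le> M * A k t" using C_le(2)[of t k] elim by (simp add: M_def)
      moreover have "e t * M \<le> 1 / 4"
      proof -
        have "M \<ge> 0" by (simp add: M_def)
        have "4 * M = sqrt (16 * M\<^sup>2)" using \<open>M \<ge> 0\<close> by (simp add: real_sqrt_mult)
        also have "\<dots> \<le> sqrt t" using elim by simp
        finally show ?thesis using elim by (simp add: e_def field_simps)
      qed
      moreover have "\<kappa> k \<ge> 0" using \<alpha> by (simp add: \<kappa>_def)
      ultimately show ?case using scaled_root_bounded[of "A k t" "e t" M "\<kappa> k"] EA[of t k] A_pos[of t k] e(1)[of t] elim
        by auto
    qed
  qed
  have bigo_cong: "f \<in> O[at_top](\<lambda>_. 1)" if "\<And>t. t > 0 \<Longrightarrow> f t = g t" "g \<in> O[at_top](\<lambda>_. 1)" for f g :: "real \<Rightarrow> real"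
  proof -
    have "\<forall>\<^sub>F t in at_top. f t = g t"
      using eventually_gt_at_top[of 0] by eventually_elim (use that(1) in simp)
    from landau_o.big.in_cong[OF this] show ?thesis using that(2) by simp
  qed
  \<comment> \<open>With divisions rewritten as products with constant inverses, every correction is
    a polynomial in bounded functions, and these rules follow its syntax.\<close>
  note bo = bigo_one_intros
  have e_O: "e \<in> O[at_top](\<lambda>_. 1)"
  proof (rule bigoI[of _ 1])
    show "\<forall>\<^sub>F t in at_top. norm (e t) \<le> 1 * norm (1::real)"
      using eventually_ge_at_top[of 1] by eventually_elim (simp add: e_def)
  qed
  have A_O: "A k \<in> O[at_top](\<lambda>_. 1)" for k
  proof (rule bigoI[of _ 2])
    show "\<forall>\<^sub>F t in at_top. norm (A k t) \<le> 2 * norm (1::real)"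
      using A_bd[of k] eventually_gt_at_top[of 0]
      by eventually_elim (use A_pos[of _ k] in \<open>simp add: less_imp_le\<close>)
  qed
  have C_O: "C k \<in> O[at_top](\<lambda>_. 1)" for k
  proof (cases k)
    case 0 then show ?thesis by (intro bigo_cong[OF _ bo(1)]) (simp add: C_0)
  next
    case (Suc j)
    have "C (Suc j) \<in> O[at_top](\<lambda>t. (2 * real (Suc j) + \<bar>\<alpha>\<bar>) * A (Suc j) t)"
    proof (rule bigoI[of _ 1])
      show "\<forall>\<^sub>F t in at_top. norm (C (Suc j) t) \<le> 1 * norm ((2 * real (Suc j) + \<bar>\<alpha>\<bar>) * A (Suc j) t)"
        using eventually_gt_at_top[of 0]
      proof eventually_elim
        case (elim t)
        show ?case using C_le(1)[of t j, OF elim] C_nonneg[OF elim, of "Suc j"] by (simp del: of_nat_Suc)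
      qed
    qed
    also have "(\<lambda>t. (2 * real (Suc j) + \<bar>\<alpha>\<bar>) * A (Suc j) t) \<in> O[at_top](\<lambda>_. 1)"
      by (intro bo A_O)
    finally show ?thesis by (simp add: Suc)
  qed
  have inv_O: "(\<lambda>t. inverse (A k t + 1)) \<in> O[at_top](\<lambda>_. 1)" for k
  proof (rule bigoI[of _ 1])
    show "\<forall>\<^sub>F t in at_top. norm (inverse (A k t + 1)) \<le> 1 * norm (1::real)"
      using eventually_gt_at_top[of 0]
    proof eventually_elim
      case (elim t)
      show ?case using A_pos[OF elim, of k] by (simp add: inverse_eq_divide)
    qed
  qed
  have A_A1: "A k t = 1 + e t * A1 k t" if "t > 0" for k t using e(1)[OF that] by (simp add: A1_def)
  have C_C1: "C k t = real k / 2 + e t * C1 k t" if "t > 0" for k t using e(1)[OF that] by (simp add: C1_def)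
  have A1_A2: "A1 k t = p k + e t * A2 k t" if "t > 0" for k t using e(1)[OF that] by (simp add: A2_def)
  have C1_C2: "C1 k t = e t * C2 k t" if "t > 0" for k t using e(1)[OF that] by (simp add: C2_def)
  have A1_O: "A1 k \<in> O[at_top](\<lambda>_. 1)" for k
  proof (rule bigo_cong)
    show "A1 k t = (C k t + C (Suc k) t - \<kappa> k * A k t) * inverse (A k t + 1)" if "t > 0" for t
      unfolding A1_def by (rule A_first_correction[OF e(1)[OF that] A_pos[OF that] EA[OF that]])
  qed (intro bo A_O C_O inv_O)
  have C1_eq: "C1 (Suc k) t = (real (Suc k) * (A1 (Suc k) t + A1 k t) + real (Suc k) * e t * A1 (Suc k) t * A1 k t
     + \<mu> (Suc k) * C (Suc k) t * A (Suc k) t * A k t - C (Suc k) t * (A1 (Suc k) t + A1 k t)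
     - C (Suc k) t * C (Suc k) t * (A (Suc k) t + A k t)) / 2" if "t > 0" for k t
    unfolding C1_def by (rule C_first_correction[OF e(1)[OF that] A_A1[OF that] A_A1[OF that] EC[OF that]])
  have C1_O: "C1 k \<in> O[at_top](\<lambda>_. 1)" for k
  proof (cases k)
    case 0 then show ?thesis by (intro bigo_cong[OF _ bo(1)]) (simp add: C_0 C1_def)
  next
    case (Suc j)
    show ?thesis unfolding Suc divide_inverse
      by (rule bigo_cong[OF C1_eq], assumption, unfold divide_inverse, intro bo A_O C_O A1_O e_O)
  qed
  have A2_eq: "A2 k t = (C1 k t + C1 (Suc k) t - \<kappa> k * A1 k t - A1 k t * A1 k t) / 2" if "t > 0" for k t
    unfolding A2_def p_def
    by (rule A_second_correction[OF e(1)[OF that] A_pos[OF that] A_A1[OF that] C_C1[OF that] _ EA[OF that]])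
       (use C_C1[OF that, of "Suc k"] in \<open>simp add: add.commute\<close>)
  have A2_O: "A2 k \<in> O[at_top](\<lambda>_. 1)" for k
    by (rule bigo_cong[OF A2_eq], assumption, unfold divide_inverse, intro bo A1_O C1_O)
  have p_sum: "p (Suc k) + p k = - (real (Suc k) + \<alpha>)" for k
    by (simp add: p_def \<kappa>_def field_simps)
  have C2_O: "C2 k \<in> O[at_top](\<lambda>_. 1)" for k
  proof (cases k)
    case 0 then show ?thesis by (intro bigo_cong[OF _ bo(1)]) (simp add: C_0 C1_def C2_def)
  next
    case (Suc j)
    show ?thesis unfolding Suc C2_def
      by (rule bigo_cong[OF C_second_correction[OF e(1) A_A1 A_A1 C_C1 A1_A2 A1_A2 p_sum _ C1_eq]], assumption+,
          simp add: \<mu>_def, assumption, unfold divide_inverse, intro bo A_O A1_O A2_O C_O C1_O e_O)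
  qed
  have A3_O: "A3 k \<in> O[at_top](\<lambda>_. 1)" for k
    unfolding A3_def
    by (rule bigo_cong[OF A_third_correction[OF e(1) A1_A2 C1_C2 C1_C2 A2_eq]], assumption+,
        unfold divide_inverse, intro bo A1_O A2_O C2_O)
  have "(\<lambda>t. A3 k t * (1 / t)) \<in> O[at_top](\<lambda>t. 1 * (1 / t))"
    by (intro landau_o.big.mult A3_O) simp
  moreover have "\<forall>\<^sub>F t in at_top. a k t - (sqrt t - (2 * real k + 1 + 2 * \<alpha>) / 4
            + (2 * real k + 1 + 2 * \<alpha>) * (6 * real k + 3 + 2 * \<alpha>) / (32 * sqrt t)) = A3 k t * (1 / t)"
    using eventually_gt_at_top[of 0]
  proof eventually_elim
    case (elim t)
    define q where "q = - p k * (\<kappa> k + p k) / 2"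
    have p: "p k = - (2 * real k + 1 + 2 * \<alpha>) / 4" by (simp add: p_def \<kappa>_def field_simps)
    have q: "q = (2 * real k + 1 + 2 * \<alpha>) * (6 * real k + 3 + 2 * \<alpha>) / 32"
      unfolding q_def p \<kappa>_def by (simp add: field_simps)
    have A2: "A2 k t = q + e t * A3 k t" using e(1)[OF elim] by (simp add: A3_def q_def)
    have st: "sqrt t * e t = 1" using elim by (simp add: e_def)
    have "a k t = sqrt t * A k t" using st by (simp add: A_def mult.left_commute)
    also have "\<dots> = sqrt t * (1 + e t * (p k + e t * (q + e t * A3 k t)))"
      using A_A1[OF elim] A1_A2[OF elim] A2 by simp
    also have "\<dots> = sqrt t + (sqrt t * e t) * (p k + e t * (q + e t * A3 k t))" by (simp add: algebra_simps)
    also have "\<dots> = sqrt t + p k + q * e t + A3 k t * (e t)\<^sup>2"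
      unfolding st by (simp add: algebra_simps power2_eq_square)
    also have "(e t)\<^sup>2 = 1 / t" using elim by (simp add: e_def power_divide)
    finally show ?case unfolding p q by (simp add: e_def field_simps)
  qed
  ultimately show ?thesis by (subst landau_o.big.in_cong) simp_all
qed

section \<open>The Hankel determinant and the subleading coefficient\<close>

text \<open>For m = 0 this is an entry of the Hankel matrix in a polynomial basis, for m = 1 minus
  its t-derivative with the basis frozen. The sums run to n rather than to the degrees to fit the n
  by n matrix.\<close>

lemma weighted_product_integral:
  assumes t: "t > 0" and deg: "degree p < n" "degree q < n"
  shows "(LBINT x:{0<..}. poly p x * poly q x * weight \<alpha> t x / x ^ m)
       = (\<Sum>i<n. \<Sum>l<n. coeff p i * coeff q l * (LBINT x:{0<..}. x ^ (i + l) * weight \<alpha> t x / x ^ m))"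
proof -
  have poly: "poly r x = (\<Sum>i<n. coeff r i * x ^ i)" if "degree r < n" for r and x :: real
    using that by (auto simp: poly_altdef intro!: sum.mono_neutral_left le_degree)
  have int: "set_integrable lborel {0<..} (\<lambda>x. coeff p i * coeff q l * (x ^ (i + l) * weight \<alpha> t x / x ^ m))" for i l
    by (intro set_integrable_mult_right weight_moment_integrable[OF t])
  have "(LBINT x:{0<..}. poly p x * poly q x * weight \<alpha> t x / x ^ m)
      = (LBINT x:{0<..}. \<Sum>i<n. \<Sum>l<n. coeff p i * coeff q l * (x ^ (i + l) * weight \<alpha> t x / x ^ m))"
  proof -
    have "poly p x * poly q x = (\<Sum>i<n. \<Sum>l<n. (coeff p i * x ^ i) * (coeff q l * x ^ l))" for x
      unfolding poly[OF deg(1)] poly[OF deg(2)] sum_product ..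
    then show ?thesis by (simp add: sum_distrib_left sum_distrib_right sum_divide_distrib power_add mult_ac)
  qed
  also have "\<dots> = (\<Sum>i<n. \<Sum>l<n. LBINT x:{0<..}. coeff p i * coeff q l * (x ^ (i + l) * weight \<alpha> t x / x ^ m))"
    using int unfolding set_lebesgue_integral_def set_integrable_def scaleR_sum_right
    by (simp add: Bochner_Integration.integral_sum Bochner_Integration.integrable_sum)
  finally show ?thesis by (simp only: set_integral_mult_right)
qed

lemma singular_laguerre_functional_weighted_integral:
  assumes t: "t > 0" and \<alpha>: "\<alpha> > -1"
  shows "singular_laguerre_functional (weighted_integral \<alpha> t) \<alpha> t"
proof
  note int = poly_weight_integrable[OF t, of _ \<alpha> 2]
  show add: "weighted_integral \<alpha> t (p + q) = weighted_integral \<alpha> t p + weighted_integral \<alpha> t q" for p q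
    unfolding weighted_integral_def set_integral_add(2)[OF int int, symmetric]
    by (simp add: ring_distribs add_divide_distrib)
  show smult: "weighted_integral \<alpha> t (smult c p) = c * weighted_integral \<alpha> t p" for c p
    unfolding weighted_integral_def set_integral_mult_right[symmetric] by (simp add: mult_ac)
  show "weighted_integral \<alpha> t p > 0" if "p \<noteq> 0" "\<And>x. x > 0 \<Longrightarrow> poly p x \<ge> 0" for p
    by (rule weighted_integral_pos[OF t that])
  show "weighted_integral \<alpha> t ([:0, 0, 1:] * pderiv p) = weighted_integral \<alpha> t ([:-t, -\<alpha>, 1:] * p)" for p
    using weighted_integral_pearson[OF t, of \<alpha> p] add[of "[:0, 0, 1:] * pderiv p - [:-t, -\<alpha>, 1:] * p" "[:-t, -\<alpha>, 1:] * p"]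
    by simp
qed (fact assms)+

context
  fixes \<alpha> t :: real
  assumes \<alpha>: "\<alpha> > -1" and t: "t > 0"
begin

interpretation singular_laguerre_functional "weighted_integral \<alpha> t" \<alpha> t
  by (rule singular_laguerre_functional_weighted_integral[OF t \<alpha>])

lemma J_integral: "J p = (LBINT x:{0<..}. poly p x * weight \<alpha> t x / x)"
  unfolding J_def weighted_integral_def
  by (rule set_lebesgue_integral_cong) (auto simp: power2_eq_square)

lemma L_integral: "L p = (LBINT x:{0<..}. poly p x * weight \<alpha> t x)"
  unfolding L_def J_integral by (rule set_lebesgue_integral_cong) auto

lemma ortho_poly_eq: "ortho_poly \<alpha> t = ortho"
  unfolding ortho_poly_def
proof (rule the_equality)
  show "monic_orthogonal \<alpha> t ortho"
    unfolding monic_orthogonal_def using h_pos L_ortho_ortho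
    by (auto simp: L_integral intro!: exI[of _ h])
next
  fix P assume P: "monic_orthogonal \<alpha> t P"
  then have "\<And>n. degree (P n) = n" "\<And>n. lead_coeff (P n) = 1"
    unfolding monic_orthogonal_def by blast+
  moreover have "L (P j * P k) = 0" if "j \<noteq> k" for j k
    using P that by (auto simp: monic_orthogonal_def L_integral)
  ultimately have "P n = ortho n" for n by (rule ortho_unique)
  then show "P = ortho" ..
qed

lemma subleading_eq: "subleading \<alpha> (Suc n) t = - (\<Sum>k<Suc n. 2 * real k + 1 + \<alpha> + a k)"
  by (simp add: subleading_def ortho_poly_eq coeff_ortho_subleading diag_eq lessThan_Suc_atMost)

text \<open>The change of basis to the orthogonal polynomials at the fixed time \<open>t\<close> leaves the determinant
  unchanged for all times \<open>s\<close>, so the polynomials themselves need not be differentiated in \<open>t\<close>.\<close>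

lemma H_log_eq: "H_log \<alpha> n t = - (\<Sum>k<n. a k)"
proof -
  define f where "f s j k = (\<Sum>i<n. \<Sum>l<n. coeff (ortho j) i * coeff (ortho k) l * moment \<alpha> s (i + l))" for s j k
  define f' where "f' j k = - (\<Sum>i<n. \<Sum>l<n. coeff (ortho j) i * coeff (ortho k) l * (LBINT x:{0<..}. x ^ (i + l) * weight \<alpha> t x / x))" for j k
  have hankel: "hankel_det \<alpha> n s = Determinant.det (Matrix.mat n n (\<lambda>(j, k). f s j k))" for s
    unfolding hankel_det_def f_def
    by (rule det_congruence_unitriangular[symmetric]) (auto simp: coeff_eq_0)
  have deriv: "((\<lambda>s. f s j k) has_real_derivative f' j k) (at t)" for j k
  proof -
    have "((\<lambda>s. f s j k) has_real_derivative
        (\<Sum>i<n. \<Sum>l<n. coeff (ortho j) i * coeff (ortho k) l * - (LBINT x:{0<..}. x ^ (i + l) * weight \<alpha> t x / x))) (at t)"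
      unfolding f_def by (intro DERIV_sum DERIV_cmult moment_has_derivative t)
    then show ?thesis by (simp add: f'_def sum_negf)
  qed
  have f: "f t j k = (if j = k then h j else 0)" if "j < n" "k < n" for j k
    using weighted_product_integral[OF t, of "ortho j" n "ortho k" \<alpha> 0] that L_ortho_ortho[of j k]
    by (simp add: f_def moment_def L_integral)
  have f': "f' k k = - J (ortho k * ortho k)" if "k < n" for k
    using weighted_product_integral[OF t, of "ortho k" n "ortho k" \<alpha> 1] that
    by (simp add: f'_def J_integral)
  have det: "hankel_det \<alpha> n t = (\<Prod>k<n. h k)"
  proof -
    have "hankel_det \<alpha> n t = prod_list (diag_mat (Matrix.mat n n (\<lambda>(j, k). f t j k)))"
      unfolding hankel by (rule det_upper_triangular[of _ n]) (auto simp: f)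
    then show ?thesis
      unfolding prod_list_diag_prod by (simp add: f atLeast0LessThan)
  qed
  have pos: "(\<Prod>k<n. h k) > 0" by (intro prod_pos h_pos)
  have "((\<lambda>s. hankel_det \<alpha> n s) has_real_derivative (\<Sum>k<n. f' k k * (\<Prod>j\<in>{..<n} - {k}. f t j j))) (at t)"
    unfolding hankel by (rule det_has_derivative_at_diagonal[OF deriv]) (simp add: f)
  also have "(\<Sum>k<n. f' k k * (\<Prod>j\<in>{..<n} - {k}. f t j j)) = (\<Sum>k<n. - (a k / t) * (\<Prod>k<n. h k))"
  proof (rule sum.cong)
    fix k assume k: "k \<in> {..<n}"
    \<comment> \<open>The diagonal derivative is -h_k a_k / t, so its h_k restores the factor that
      the product rule omits.\<close>
    have "(\<Prod>j<n. h j) = h k * (\<Prod>j\<in>{..<n} - {k}. h j)" using k by (intro prod.remove) auto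
    moreover have "(\<Prod>j\<in>{..<n} - {k}. f t j j) = (\<Prod>j\<in>{..<n} - {k}. h j)"
      by (rule prod.cong) (auto simp: f)
    ultimately show "f' k k * (\<Prod>j\<in>{..<n} - {k}. f t j j) = - (a k / t) * (\<Prod>k<n. h k)"
      using k t h_pos[of k] by (simp add: f' a_def)
  qed simp
  also have "\<dots> = - (\<Sum>k<n. a k) / t * (\<Prod>k<n. h k)"
    by (simp add: sum_negf sum_distrib_right sum_divide_distrib)
  finally have "((\<lambda>s. ln (hankel_det \<alpha> n s)) has_real_derivative
      - (\<Sum>k<n. a k) / t * (\<Prod>k<n. h k) / (\<Prod>k<n. h k)) (at t)"
    using pos by (auto intro!: derivative_eq_intros simp: det field_simps)
  then have "deriv (\<lambda>s. ln (hankel_det \<alpha> n s)) t = - (\<Sum>k<n. a k) / t"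
    using pos by (metis DERIV_imp_deriv less_irrefl nonzero_mult_div_cancel_right)
  then show ?thesis using t by (simp add: H_log_def)
qed

end

text \<open>The last term is a telescoping sum: (2n + 1 + 2\<alpha>)(6n + 3 + 2\<alpha>) is the
  increment of n (4 (\<alpha> + n)^2 - 1) from n to n + 1.\<close>

lemma sum_expansion:
  fixes s \<alpha> :: real
  shows "(\<Sum>k<n. s - (2 * real k + 1 + 2 * \<alpha>) / 4 + (2 * real k + 1 + 2 * \<alpha>) * (6 * real k + 3 + 2 * \<alpha>) / (32 * s))
       = real n * s - real n * (2 * \<alpha> + real n) / 4 + real n * (4 * (\<alpha> + real n)\<^sup>2 - 1) / (32 * s)"
proof (induction n)
  case (Suc n)
  have "real n * (4 * (\<alpha> + real n)\<^sup>2 - 1) + (2 * real n + 1 + 2 * \<alpha>) * (6 * real n + 3 + 2 * \<alpha>)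
      = real (Suc n) * (4 * (\<alpha> + real (Suc n))\<^sup>2 - 1)"
    by (simp add: algebra_simps power2_eq_square)
  then have "real n * (4 * (\<alpha> + real n)\<^sup>2 - 1) / (32 * s)
      + (2 * real n + 1 + 2 * \<alpha>) * (6 * real n + 3 + 2 * \<alpha>) / (32 * s)
      = real (Suc n) * (4 * (\<alpha> + real (Suc n))\<^sup>2 - 1) / (32 * s)"
    by (simp only: add_divide_distrib[symmetric])
  moreover have "real n * s - real n * (2 * \<alpha> + real n) / 4 + (s - (2 * real n + 1 + 2 * \<alpha>) / 4)
      = real (Suc n) * s - real (Suc n) * (2 * \<alpha> + real (Suc n)) / 4"
    by (simp add: field_simps)
  ultimately show ?case using Suc by simp
qed simp

theorem theorem5p3:
  fixes \<alpha> :: real and n :: nat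
  assumes "\<alpha> > -1" and "n \<ge> 1"
  shows "(\<lambda>t. subleading \<alpha> n t -
            (- real n * sqrt t - real n * (2 * \<alpha> + 3 * real n) / 4
             - real n * (4 * (\<alpha> + real n)^2 - 1) / (32 * sqrt t)))
          \<in> O[at_top](\<lambda>t. 1 / t) \<and>
         (\<lambda>t. H_log \<alpha> n t -
            (- real n * sqrt t + real n * (2 * \<alpha> + real n) / 4
             - real n * (4 * (\<alpha> + real n)^2 - 1) / (32 * sqrt t)))
          \<in> O[at_top](\<lambda>t. 1 / t)"
proof -
  \<comment> \<open>The locale lives at a single t; \<open>u\<close> and \<open>v\<close> collect
    its coefficients into functions of t, whose properties are checked by a separate interpretation
    at each t.\<close>
  define u where "u k t = singular_laguerre_functional.a (weighted_integral \<alpha> t) t k" for k t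
  define v where "v k t = singular_laguerre_functional.c (weighted_integral \<alpha> t) t k" for k t
  note F = singular_laguerre_functional_weighted_integral[OF _ assms(1)]
  let ?e = "\<lambda>k t. u k t - (sqrt t - (2 * real k + 1 + 2 * \<alpha>) / 4
            + (2 * real k + 1 + 2 * \<alpha>) * (6 * real k + 3 + 2 * \<alpha>) / (32 * sqrt t))"
  have "?e k \<in> O[at_top](\<lambda>t. 1 / t)" for k
  proof (rule recurrence_asymptotics[OF assms(1), where c = v])
    fix k and t :: real assume t: "t > 0"
    interpret singular_laguerre_functional "weighted_integral \<alpha> t" \<alpha> t by (rule F[OF t])
    show "u k t > 0" unfolding u_def by (rule a_pos)
    show "v 0 t = 0" unfolding v_def by (simp add: c_def)
    show "v k t \<ge> 0" unfolding v_def using c_pos by (cases k) (auto simp: less_imp_le c_def)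
    show "(u k t)\<^sup>2 + (2 * real k + 1 + \<alpha>) * u k t = t + v k t + v (Suc k) t"
      unfolding u_def v_def a_diag[symmetric] diag_eq by (simp add: power2_eq_square algebra_simps)
    show "v (Suc k) t * (v (Suc k) t + t) * (u (Suc k) t + u k t)
        = (real (Suc k) * t + (2 * real (Suc k) + \<alpha>) * v (Suc k) t) * u (Suc k) t * u k t"
      unfolding u_def v_def by (rule c_system)
  qed
  then have E: "(\<lambda>t. - (\<Sum>k<n. ?e k t)) \<in> O[at_top](\<lambda>t. 1 / t)"
    by (subst landau_o.big.uminus_in_iff) (intro big_sum_in_bigo)
  have e: "- (\<Sum>k<n. ?e k t) = - (\<Sum>k<n. u k t)
      - (- real n * sqrt t + real n * (2 * \<alpha> + real n) / 4 - real n * (4 * (\<alpha> + real n)^2 - 1) / (32 * sqrt t))" for t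
    unfolding sum_subtractf[of "\<lambda>k. u k t"] sum_expansion by simp
  have H: "H_log \<alpha> n t = - (\<Sum>k<n. u k t)" if "t > 0" for t
    unfolding u_def by (rule H_log_eq[OF assms(1) that])
  have p: "subleading \<alpha> n t = - (\<Sum>k<n. u k t) - real n * (real n + \<alpha>)" if "t > 0" for t
  proof -
    obtain m where m: "n = Suc m" using assms(2) by (cases n) auto
    \<comment> \<open>This explicit part of the diagonal coefficients turns the constant term n
      (2\<alpha> + n)/4 of H_n into -n (2\<alpha> + 3n)/4.\<close>
    have "(\<Sum>k<n. 2 * real k + 1 + \<alpha>) = real n * (real n + \<alpha>)" for n
      by (induction n) (auto simp: algebra_simps)
    then show ?thesis
      using subleading_eq[OF assms(1) that, of m] unfolding u_def m by (simp only: sum.distrib minus_add_distrib)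
  qed
  show ?thesis
  proof
    show "(\<lambda>t. subleading \<alpha> n t -
            (- real n * sqrt t - real n * (2 * \<alpha> + 3 * real n) / 4
             - real n * (4 * (\<alpha> + real n)^2 - 1) / (32 * sqrt t))) \<in> O[at_top](\<lambda>t. 1 / t)"
    proof (subst landau_o.big.in_cong[OF _ ])
      show "\<forall>\<^sub>F t in at_top. subleading \<alpha> n t -
            (- real n * sqrt t - real n * (2 * \<alpha> + 3 * real n) / 4
             - real n * (4 * (\<alpha> + real n)^2 - 1) / (32 * sqrt t)) = - (\<Sum>k<n. ?e k t)"
        using eventually_gt_at_top[of 0] by eventually_elim (simp only: e p, simp add: field_simps)
    qed (rule E)
    show "(\<lambda>t. H_log \<alpha> n t -
            (- real n * sqrt t + real n * (2 * \<alpha> + real n) / 4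
             - real n * (4 * (\<alpha> + real n)^2 - 1) / (32 * sqrt t))) \<in> O[at_top](\<lambda>t. 1 / t)"
    proof (subst landau_o.big.in_cong)
      show "\<forall>\<^sub>F t in at_top. H_log \<alpha> n t -
            (- real n * sqrt t + real n * (2 * \<alpha> + real n) / 4
             - real n * (4 * (\<alpha> + real n)^2 - 1) / (32 * sqrt t)) = - (\<Sum>k<n. ?e k t)"
        using eventually_gt_at_top[of 0] by eventually_elim (simp only: e H)
    qed (rule E)
  qed
qed

end
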